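(* Let $d \in \{1,2,3\}$, let $\Omega \subset \mathbb{R}^d$ be a bounded Lipschitz domain, let $T>0$ and $Q = \Omega \times (0,T)$. Then $$H^1_{0;0,}(Q;\square) \not\subset H^2(0,T;L^2(\Omega)),$$ and thus, $H^1_{0;0,}(Q;\square) \not\subset H^2(Q)$.
   Context: All functions are real-valued. $H^1_{0,}(0,T;L^2(\Omega))$ denotes the space of $v \in H^1(0,T;L^2(\Omega))$ with $v(0)=0$. Set $$H^{1,1}_{0;0,}(Q) = H^1_{0,}(0,T;L^2(\Omega)) \cap L^2(0,T;H^1_0(\Omega)) \subset H^1(Q).$$ $\square = \partial_{tt} - \Delta_x$ is the distributional wave operator (wave speed $1$): for $v \in L^2(Q)$ and $g\in L^2(Q)$, $\square v = g$ means $\langle v, \partial_{tt}\varphi\rangle_{L^2(Q)} - \langle v, \Delta_x \varphi\rangle_{L^2(Q)} = \langle g, \varphi\rangle_{L^2(Q)}$ for all $\varphi \in C_0^\infty(Q)$; $\square v \in L^2(Q)$ means that such a $g$ exists. The space in question is $$H^1_{0;0,}(Q;\square) = \{ v \in H^{1,1}_{0;0,}(Q) : \square v \in L^2(Q) \text{ and } \partial_t v(\cdot,0) = 0 \},$$ where the condition $\partial_t v(\cdot,0)=0$ is well-defined because $v \in H^{1,1}_{0;0,}(Q)$ with $\square v \in L^2(Q)$ satisfies $\partial_t v \in C([0,T];[H^1_0(\Omega)]')$, with $[H^1_0(\Omega)]'$ the dual space of $H^1_0(\Omega)$. $H^2(0,T;L^2(\Omega))$ is the usual Bochner–Sobolev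 space of functions $v$ with $v, \partial_t v, \partial_{tt} v \in L^2(0,T;L^2(\Omega))$ (identified with $L^2(Q)$), and $H^2(Q)$ is the usual Sobolev space on the space-time domain $Q \subset \mathbb{R}^{d+1}$. *)

theory Defs
  imports "HOL-Analysis.Analysis"
begin

section \<open>Lipschitz domains\<close>

text \<open>Near every boundary point, the set is the strict epigraph of a Lipschitz function
  over the hyperplane orthogonal to a unit vector \<open>e\<close>, i.e. in a rotated coordinate system
  with last axis \<open>e\<close>.\<close>

definition lipschitz_boundary :: "'a::euclidean_space set \<Rightarrow> bool" where
  "lipschitz_boundary S \<longleftrightarrow>
    (\<forall>p\<in>frontier S. \<exists>r>0. \<exists>e L. \<exists>\<gamma> :: 'a \<Rightarrow> real.
      norm e = 1 \<and> L-lipschitz_on {y. y \<bullet> e = 0} \<gamma> \<and>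
      S \<inter> ball p r = {x \<in> ball p r. \<gamma> (x - (x \<bullet> e) *\<^sub>R e) < x \<bullet> e})"

definition bounded_lipschitz_domain :: "'a::euclidean_space set \<Rightarrow> bool" where
  "bounded_lipschitz_domain S \<longleftrightarrow>
    S \<noteq> {} \<and> open S \<and> connected S \<and> bounded S \<and> lipschitz_boundary S"


section \<open>Test functions\<close>

definition dir_deriv :: "'a::euclidean_space \<Rightarrow> ('a \<Rightarrow> real) \<Rightarrow> 'a \<Rightarrow> real" where
  "dir_deriv i f x = frechet_derivative f (at x) i"

primrec Ck :: "nat \<Rightarrow> ('a::euclidean_space \<Rightarrow> real) \<Rightarrow> bool" where
  "Ck 0 f \<longleftrightarrow> continuous_on UNIV f"
| "Ck (Suc k) f \<longleftrightarrow> f differentiable_on UNIV \<and> (\<forall>i\<in>Basis. Ck k (dir_deriv i f))"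

text \<open>\<open>C\<^sub>0\<^sup>\<infinity>(S)\<close>, extended by zero to the whole space.\<close>

definition test_functions :: "'a::euclidean_space set \<Rightarrow> ('a \<Rightarrow> real) set" where
  "test_functions S =
    {\<phi>. (\<forall>k. Ck k \<phi>) \<and> compact (closure {x. \<phi> x \<noteq> 0}) \<and> closure {x. \<phi> x \<noteq> 0} \<subseteq> S}"


section \<open>Sobolev spaces\<close>

text \<open>Function spaces are sets of representatives: Borel functions on \<open>S\<close>, which may be
  arbitrary outside \<open>S\<close>. Every class of Lebesgue-measurable functions modulo null sets has a
  Borel representative. All conditions below are invariant under changing a function
  on a null subset of \<open>S\<close> (within the Borel functions).\<close>

definition L2 :: "'a::euclidean_space set \<Rightarrow> ('a \<Rightarrow> real) set" where
  "L2 S = {f. set_borel_measurable lborel S f \<and> set_integrable lborel S (\<lambda>x. (f x)\<^sup>2)}"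

definition L2_norm :: "'a::euclidean_space set \<Rightarrow> ('a \<Rightarrow> real) \<Rightarrow> real" where
  "L2_norm S f = sqrt (LINT x:S|lborel. (f x)\<^sup>2)"

definition has_weak_deriv ::
  "'a::euclidean_space set \<Rightarrow> 'a \<Rightarrow> ('a \<Rightarrow> real) \<Rightarrow> ('a \<Rightarrow> real) \<Rightarrow> bool" where
  "has_weak_deriv S i u g \<longleftrightarrow> u \<in> L2 S \<and> g \<in> L2 S \<and>
    (\<forall>\<phi>\<in>test_functions S.
      (LINT x:S|lborel. u x * dir_deriv i \<phi> x) = - (LINT x:S|lborel. g x * \<phi> x))"

text \<open>\<open>H\<^sup>k(S) = W\<^sup>k\<^sup>,\<^sup>2(S)\<close>.\<close>

primrec sobolev :: "nat \<Rightarrow> 'a::euclidean_space set \<Rightarrow> ('a \<Rightarrow> real) set" where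
  "sobolev 0 S = L2 S"
| "sobolev (Suc k) S = {u \<in> L2 S. \<forall>i\<in>Basis. \<exists>g\<in>sobolev k S. has_weak_deriv S i u g}"

definition weak_deriv :: "'a::euclidean_space set \<Rightarrow> 'a \<Rightarrow> ('a \<Rightarrow> real) \<Rightarrow> 'a \<Rightarrow> real" where
  "weak_deriv S i u = (SOME g. has_weak_deriv S i u g)"

definition H1_norm :: "'a::euclidean_space set \<Rightarrow> ('a \<Rightarrow> real) \<Rightarrow> real" where
  "H1_norm S u = sqrt ((L2_norm S u)\<^sup>2 + (\<Sum>i\<in>Basis. (L2_norm S (weak_deriv S i u))\<^sup>2))"

text \<open>\<open>H\<^sup>1\<^sub>0(S)\<close> is the closure of the test functions in \<open>H\<^sup>1(S)\<close>.\<close>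

definition H10 :: "'a::euclidean_space set \<Rightarrow> ('a \<Rightarrow> real) set" where
  "H10 S = {u \<in> sobolev 1 S. \<forall>\<epsilon>>0. \<exists>\<phi>\<in>test_functions S. H1_norm S (\<lambda>x. u x - \<phi> x) < \<epsilon>}"

text \<open>The dual of \<open>H\<^sup>1\<^sub>0(S)\<close>; functionals are determined by their values on \<open>H10 S\<close> only.
  Boundedness forces them to respect equality almost everywhere.\<close>

definition H10_dual :: "'a::euclidean_space set \<Rightarrow> (('a \<Rightarrow> real) \<Rightarrow> real) set" where
  "H10_dual S = {l.
    (\<forall>u\<in>H10 S. \<forall>v\<in>H10 S. \<forall>a b. l (\<lambda>x. a * u x + b * v x) = a * l u + b * l v) \<and>
    (\<exists>C. \<forall>u\<in>H10 S. \<bar>l u\<bar> \<le> C * H1_norm S u)}"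

definition H10_dual_norm :: "'a::euclidean_space set \<Rightarrow> (('a \<Rightarrow> real) \<Rightarrow> real) \<Rightarrow> real" where
  "H10_dual_norm S l = (SUP u \<in> {u \<in> H10 S. H1_norm S u \<le> 1}. \<bar>l u\<bar>)"


section \<open>Spaces on the space-time cylinder\<close>

text \<open>Points of \<open>Q\<close> are pairs \<open>(x, t)\<close>. \<open>L\<^sup>2(0,T;L\<^sup>2(\<Omega>))\<close> is identified with \<open>L\<^sup>2(Q)\<close>.\<close>

definition cylinder :: "'a::euclidean_space set \<Rightarrow> real \<Rightarrow> ('a \<times> real) set" where
  "cylinder \<Omega> T = \<Omega> \<times> {0<..<T}"

text \<open>The weak derivative of the \<open>L\<^sup>2(\<Omega>)\<close>-valued function \<open>t \<mapsto> v(\<cdot>,t)\<close>: the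
  \<open>L\<^sup>2(\<Omega>)\<close>-valued Bochner integrals of \<open>\<phi>' v\<close> and \<open>- \<phi> g\<close> over \<open>(0,T)\<close> agree as elements of
  \<open>L\<^sup>2(\<Omega>)\<close>; these integrals are computed pointwise at almost every \<open>x\<close>.\<close>

definition has_time_deriv ::
  "'a::euclidean_space set \<Rightarrow> real \<Rightarrow> ('a \<times> real \<Rightarrow> real) \<Rightarrow> ('a \<times> real \<Rightarrow> real) \<Rightarrow> bool" where
  "has_time_deriv \<Omega> T v g \<longleftrightarrow> v \<in> L2 (cylinder \<Omega> T) \<and> g \<in> L2 (cylinder \<Omega> T) \<and>
    (\<forall>\<phi>\<in>test_functions {0<..<T}. AE x\<in>\<Omega> in lborel.
      (LINT t:{0<..<T}|lborel. deriv \<phi> t * v (x, t)) =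
      - (LINT t:{0<..<T}|lborel. \<phi> t * g (x, t)))"

primrec Hk_time :: "nat \<Rightarrow> 'a::euclidean_space set \<Rightarrow> real \<Rightarrow> ('a \<times> real \<Rightarrow> real) set" where
  "Hk_time 0 \<Omega> T = L2 (cylinder \<Omega> T)"
| "Hk_time (Suc k) \<Omega> T =
    {v \<in> L2 (cylinder \<Omega> T). \<exists>g\<in>Hk_time k \<Omega> T. has_time_deriv \<Omega> T v g}"

text \<open>\<open>v(\<cdot>,0) = 0\<close>, in the sense that \<open>v\<close> has a representative \<open>w\<close> in \<open>C([0,T]; L\<^sup>2(\<Omega>))\<close>
  with \<open>w(0) = 0\<close>.\<close>

definition zero_initial_value ::
  "'a::euclidean_space set \<Rightarrow> real \<Rightarrow> ('a \<times> real \<Rightarrow> real) \<Rightarrow> bool" where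
  "zero_initial_value \<Omega> T v \<longleftrightarrow> (\<exists>w :: real \<Rightarrow> 'a \<Rightarrow> real.
    (\<forall>t\<in>{0..T}. w t \<in> L2 \<Omega>) \<and>
    (\<forall>t\<in>{0..T}. ((\<lambda>s. L2_norm \<Omega> (\<lambda>x. w s x - w t x)) \<longlongrightarrow> 0) (at t within {0..T})) \<and>
    (AE t\<in>{0<..<T} in lborel. AE x\<in>\<Omega> in lborel. v (x, t) = w t x) \<and>
    (AE x\<in>\<Omega> in lborel. w 0 x = 0))"

definition H1_time_0 :: "'a::euclidean_space set \<Rightarrow> real \<Rightarrow> ('a \<times> real \<Rightarrow> real) set" where
  "H1_time_0 \<Omega> T = {v \<in> Hk_time 1 \<Omega> T. zero_initial_value \<Omega> T v}"

text \<open>\<open>L\<^sup>2(0,T; H\<^sup>1\<^sub>0(\<Omega>))\<close>: square integrability of \<open>t \<mapsto> \<parallel>v(\<cdot>,t)\<parallel>\<close> in the \<open>H\<^sup>1\<close>-norm means that the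
  spatial weak derivatives of the slices \<open>v(\<cdot>,t)\<close> form functions in \<open>L\<^sup>2(Q)\<close>.\<close>

definition L2_time_H10 :: "'a::euclidean_space set \<Rightarrow> real \<Rightarrow> ('a \<times> real \<Rightarrow> real) set" where
  "L2_time_H10 \<Omega> T = {v \<in> L2 (cylinder \<Omega> T).
    (AE t\<in>{0<..<T} in lborel. (\<lambda>x. v (x, t)) \<in> H10 \<Omega>) \<and>
    (\<forall>i\<in>Basis. \<exists>g\<in>L2 (cylinder \<Omega> T). AE t\<in>{0<..<T} in lborel.
      has_weak_deriv \<Omega> i (\<lambda>x. v (x, t)) (\<lambda>x. g (x, t)))}"

definition H11_00 :: "'a::euclidean_space set \<Rightarrow> real \<Rightarrow> ('a \<times> real \<Rightarrow> real) set" where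
  "H11_00 \<Omega> T = H1_time_0 \<Omega> T \<inter> L2_time_H10 \<Omega> T"

definition has_wave ::
  "'a::euclidean_space set \<Rightarrow> real \<Rightarrow> ('a \<times> real \<Rightarrow> real) \<Rightarrow> ('a \<times> real \<Rightarrow> real) \<Rightarrow> bool" where
  "has_wave \<Omega> T v g \<longleftrightarrow> v \<in> L2 (cylinder \<Omega> T) \<and> g \<in> L2 (cylinder \<Omega> T) \<and>
    (\<forall>\<phi>\<in>test_functions (cylinder \<Omega> T).
      (LINT z:cylinder \<Omega> T|lborel. v z * dir_deriv (0, 1) (dir_deriv (0, 1) \<phi>) z)
      - (LINT z:cylinder \<Omega> T|lborel.
          v z * (\<Sum>i\<in>Basis. dir_deriv (i, 0) (dir_deriv (i, 0) \<phi>) z))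
      = (LINT z:cylinder \<Omega> T|lborel. g z * \<phi> z))"

text \<open>\<open>\<partial>\<^sub>t v(\<cdot>,0) = 0\<close>, in the sense that \<open>\<partial>\<^sub>t v\<close>, embedded in the dual of \<open>H\<^sup>1\<^sub>0(\<Omega>)\<close> through
  the inner product of \<open>L\<^sup>2(\<Omega>)\<close>, has a representative \<open>W\<close> which is continuous on \<open>[0,T]\<close> in
  the dual norm and satisfies \<open>W(0) = 0\<close>.\<close>

definition zero_initial_velocity ::
  "'a::euclidean_space set \<Rightarrow> real \<Rightarrow> ('a \<times> real \<Rightarrow> real) \<Rightarrow> bool" where
  "zero_initial_velocity \<Omega> T v \<longleftrightarrow>
    (\<exists>g. has_time_deriv \<Omega> T v g \<and>
      (\<exists>W :: real \<Rightarrow> ('a \<Rightarrow> real) \<Rightarrow> real.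
        (\<forall>t\<in>{0..T}. W t \<in> H10_dual \<Omega>) \<and>
        (\<forall>t\<in>{0..T}. ((\<lambda>s. H10_dual_norm \<Omega> (\<lambda>u. W s u - W t u)) \<longlongrightarrow> 0) (at t within {0..T})) \<and>
        (AE t\<in>{0<..<T} in lborel. \<forall>u\<in>H10 \<Omega>. W t u = (LINT x:\<Omega>|lborel. g (x, t) * u x)) \<and>
        (\<forall>u\<in>H10 \<Omega>. W 0 u = 0)))"

text \<open>\<open>H\<^sup>1\<^sub>0\<^sub>;\<^sub>0\<^sub>,(Q;\<box>)\<close>.\<close>

definition H1_wave :: "'a::euclidean_space set \<Rightarrow> real \<Rightarrow> ('a \<times> real \<Rightarrow> real) set" where
  "H1_wave \<Omega> T =
    {v \<in> H11_00 \<Omega> T. (\<exists>g. has_wave \<Omega> T v g) \<and> zero_initial_velocity \<Omega> T v}"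

end

theory Submission
  imports Defs "HOL-Computational_Algebra.Polynomial"
begin

text \<open>Solutions of the wave equation carry singularities along characteristics, and a jump of the
  gradient across a characteristic hyperplane is invisible to the wave operator. This gives an
  explicit function in the space that has no second time derivative in \<open>L\<^sup>2\<close>. Let \<open>a\<close> be a unit
  vector, \<open>s(x,t) = x \<bullet> a + t + c\<close>, and let \<open>\<eta>\<close> be a smooth bump with compact support in the
  cylinder \<open>Q\<close> that does not vanish identically on the hyperplane \<open>s = 0\<close>. Put \<open>v = \<eta> \<bar>s\<bar>\<close>. In the sense of
  distributions
  \<open>\<box>v = \<bar>s\<bar> \<box>\<eta> + 2 (\<partial>\<^sub>t \<eta> - a \<bullet> \<nabla>\<eta>) sgn s + 2 \<eta> (1 - \<bar>a\<bar>\<^sup>2) \<delta>(s)\<close>,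
  and the singular term drops out because the direction \<open>(a, 1)\<close> is null. Hence \<open>\<box>v\<close> is bounded.
  The boundary and initial conditions hold because \<open>v\<close> vanishes near the boundary of \<open>Q\<close>.
  On the other hand \<open>\<partial>\<^sub>t\<^sub>t v\<close> contains the point masses \<open>2 \<eta> \<delta>(s)\<close> on almost every line in
  the time direction that meets the region where \<open>\<eta> \<noteq> 0\<close> and \<open>s = 0\<close>, and such masses are not
  integrable functions.

  Membership in the space is \<open>kink_H1_wave\<close>. All weak identities for \<open>v\<close>, as well as \<open>H\<^sup>1\<^sub>0\<close> of
  its slices, are obtained by dominated convergence from the smooth functions in which \<open>\<bar>s\<bar>\<close> is
  replaced by \<open>sqrt (s\<^sup>2 + 1/(n+1))\<close>: values and first derivatives converge everywhere and stay
  bounded on bounded sets, and so do their images under the wave operator, since the unbounded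
  second derivative occurs there with the factor \<open>1 - \<bar>a\<bar>\<^sup>2 = 0\<close>. By \<open>fundamental_lemma\<close>
  weak derivatives are unique up to null sets, so that the \<open>H\<^sup>1\<close>-norm, which involves a choice of
  weak derivatives, can be computed from these limits.

  Non-membership in \<open>H\<^sup>2(0,T;L\<^sup>2(\<Omega>))\<close> is \<open>kink_not_Hk_time_2\<close>. For \<open>H\<^sup>2(Q)\<close> it follows because
  \<open>H\<^sup>k(Q)\<close> is contained in \<open>H\<^sup>k(0,T;L\<^sup>2(\<Omega>))\<close>, which is \<open>sobolev_subset_Hk_time\<close>.\<close>

section \<open>Smooth functions\<close>

definition smooth :: "('a::euclidean_space \<Rightarrow> real) \<Rightarrow> bool" where
  "smooth f \<longleftrightarrow> (\<forall>k. Ck k f)"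

lemma dir_deriv_eqI: "(f has_derivative f') (at x) \<Longrightarrow> dir_deriv i f x = f' i"
  unfolding dir_deriv_def by (metis frechet_derivative_at)

lemma dir_deriv_funI: "(\<And>x. (f has_derivative f' x) (at x)) \<Longrightarrow> dir_deriv i f = (\<lambda>x. f' x i)"
  by (rule ext) (rule dir_deriv_eqI)

lemma has_derivative_frechet:
  "f differentiable_on UNIV \<Longrightarrow> (f has_derivative frechet_derivative f (at x)) (at x)"
  by (simp add: differentiable_on_def frechet_derivative_works)

lemma Ck_SucD: "Ck (Suc k) f \<Longrightarrow> Ck k f"
proof (induction k arbitrary: f)
  case 0
  then show ?case by (auto intro: differentiable_imp_continuous_on)
next
  case (Suc k)
  then show ?case using Ck.simps(2) by metis
qed

lemma smooth_iff:
  "smooth f \<longleftrightarrow> f differentiable_on UNIV \<and> (\<forall>i\<in>Basis. smooth (dir_deriv i f))"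
  unfolding smooth_def using Ck_SucD Ck.simps(2) by blast

text \<open>A family of functions that is closed under partial derivatives consists of smooth
  functions. This avoids formulas for derivatives of higher order.\<close>

lemma smooth_coinduct:
  assumes "X f"
    and step: "\<And>f. X f \<Longrightarrow> f differentiable_on UNIV \<and> (\<forall>i\<in>Basis. X (dir_deriv i f))"
  shows "smooth f"
proof -
  have "X f \<Longrightarrow> Ck k f" for k f
  proof (induction k arbitrary: f)
    case 0
    then show ?case using step by (auto intro: differentiable_imp_continuous_on)
  next
    case (Suc k)
    then show ?case using step by simp
  qed
  then show ?thesis using assms(1) by (simp add: smooth_def)
qed

lemma smooth_dir_deriv: "smooth f \<Longrightarrow> i \<in> Basis \<Longrightarrow> smooth (dir_deriv i f)"
  by (simp add: smooth_iff[of f])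

lemma smooth_differentiable: "smooth f \<Longrightarrow> f differentiable_on UNIV"
  by (simp add: smooth_iff[of f])

lemma smooth_has_derivative: "smooth f \<Longrightarrow> (f has_derivative frechet_derivative f (at x)) (at x)"
  by (rule has_derivative_frechet[OF smooth_differentiable])

lemma smooth_continuous: "smooth f \<Longrightarrow> continuous_on A f"
  by (metis smooth_def Ck.simps(1) continuous_on_subset subset_UNIV)

lemma smooth_measurable: "smooth f \<Longrightarrow> f \<in> borel_measurable borel"
  by (intro borel_measurable_continuous_onI smooth_continuous)

lemma dir_deriv_const [simp]: "dir_deriv i (\<lambda>x. c) = (\<lambda>x. 0)"
  by (subst dir_deriv_funI[where f' = "\<lambda>x h. 0"]) (auto intro!: derivative_eq_intros)

lemma dir_deriv_add:
  assumes "f differentiable_on UNIV" "g differentiable_on UNIV"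
  shows "dir_deriv i (\<lambda>x. f x + g x) = (\<lambda>x. dir_deriv i f x + dir_deriv i g x)"
  unfolding dir_deriv_def[of i f] dir_deriv_def[of i g]
  by (rule dir_deriv_funI) (intro has_derivative_add has_derivative_frechet assms)

lemma dir_deriv_mult:
  assumes "f differentiable_on UNIV" "g differentiable_on UNIV"
  shows "dir_deriv i (\<lambda>x. f x * g x) = (\<lambda>x. f x * dir_deriv i g x + dir_deriv i f x * g x)"
  unfolding dir_deriv_def[of i f] dir_deriv_def[of i g]
  by (rule dir_deriv_funI) (intro has_derivative_mult has_derivative_frechet assms)

lemma dir_deriv_expand:
  assumes "f differentiable_on UNIV"
  shows "dir_deriv v f x = (\<Sum>j\<in>Basis. (v \<bullet> j) * dir_deriv j f x)"
proof -
  interpret linear "frechet_derivative f (at x)"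
    using has_derivative_frechet[OF assms] has_derivative_linear by blast
  have "frechet_derivative f (at x) v = frechet_derivative f (at x) (\<Sum>j\<in>Basis. (v \<bullet> j) *\<^sub>R j)"
    by (simp add: euclidean_representation)
  then show ?thesis unfolding dir_deriv_def by (simp add: sum scale)
qed

lemma dir_deriv_affine:
  assumes f: "f differentiable_on UNIV" and L: "bounded_linear L"
  shows "dir_deriv i (\<lambda>x. f (L x + b)) = (\<lambda>x. dir_deriv (L i) f (L x + b))"
  unfolding dir_deriv_def[of "L i" f]
proof (rule dir_deriv_funI)
  fix x
  have "((\<lambda>x. L x + b) has_derivative L) (at x)"
    using bounded_linear_imp_has_derivative[OF L] by (intro derivative_eq_intros) auto
  from has_derivative_compose[OF this has_derivative_frechet[OF f]]
  show "((\<lambda>x. f (L x + b)) has_derivative (\<lambda>h. frechet_derivative f (at (L x + b)) (L h))) (at x)" .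
qed

lemma dir_deriv_chain:
  fixes g :: "real \<Rightarrow> real"
  assumes g: "g differentiable_on UNIV" and f: "f differentiable_on UNIV"
  shows "dir_deriv i (\<lambda>x. g (f x)) = (\<lambda>x. dir_deriv 1 g (f x) * dir_deriv i f x)"
proof -
  have "dir_deriv i (\<lambda>x. g (f x)) =
      (\<lambda>x. frechet_derivative g (at (f x)) (frechet_derivative f (at x) i))"
    by (rule dir_deriv_funI)
      (rule has_derivative_compose[OF has_derivative_frechet[OF f] has_derivative_frechet[OF g]])
  also have "\<dots> = (\<lambda>x. dir_deriv (dir_deriv i f x) g (f x))"
    by (simp add: dir_deriv_def)
  also have "\<dots> = (\<lambda>x. dir_deriv 1 g (f x) * dir_deriv i f x)"
    by (rule ext, subst dir_deriv_expand[OF g]) (simp add: mult.commute)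
  finally show ?thesis .
qed

lemma differentiable_on_affine:
  assumes f: "f differentiable_on UNIV" and L: "bounded_linear L"
  shows "(\<lambda>x. f (L x + b)) differentiable_on UNIV"
proof -
  have "(\<lambda>x. L x + b) differentiable_on UNIV"
    using bounded_linear_imp_differentiable_on[OF L] by (intro derivative_intros) auto
  then show ?thesis
    using f unfolding differentiable_on_def
    by (auto intro!: differentiable_compose[of f "\<lambda>x. L x + b"])
qed

lemma Ck_const: "Ck k (\<lambda>x. c)"
  by (induction k arbitrary: c) auto

lemma Ck_add: "Ck k f \<Longrightarrow> Ck k g \<Longrightarrow> Ck k (\<lambda>x. f x + g x)"
proof (induction k arbitrary: f g)
  case (Suc k)
  then show ?case by (auto simp: dir_deriv_add intro: derivative_intros)
qed (auto intro: continuous_intros)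

lemma Ck_mult: "Ck k f \<Longrightarrow> Ck k g \<Longrightarrow> Ck k (\<lambda>x. f x * g x)"
proof (induction k arbitrary: f g)
  case (Suc k)
  then show ?case
    using Ck_SucD[of k f] Ck_SucD[of k g]
    by (auto simp: dir_deriv_mult intro!: derivative_intros Ck_add)
qed (auto intro: continuous_intros)

lemma Ck_sum: "finite A \<Longrightarrow> (\<And>j. j \<in> A \<Longrightarrow> Ck k (f j)) \<Longrightarrow> Ck k (\<lambda>x. \<Sum>j\<in>A. f j x)"
  by (induction A rule: finite_induct) (auto intro: Ck_const Ck_add)

lemma Ck_affine:
  assumes L: "bounded_linear L"
  shows "Ck k f \<Longrightarrow> Ck k (\<lambda>x. f (L x + b))"
proof (induction k arbitrary: f)
  case 0
  have "continuous_on UNIV (\<lambda>x. L x + b)"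
    by (intro continuous_intros bounded_linear.continuous_on[OF L])
  with 0 show ?case by (auto intro: continuous_on_compose2)
next
  case (Suc k)
  then have "Ck k (\<lambda>x. \<Sum>j\<in>Basis. (L i \<bullet> j) * dir_deriv j f (L x + b))" for i
    by (intro Ck_sum Ck_mult Ck_const) auto
  with Suc.prems show ?case
    by (auto simp: dir_deriv_affine[OF _ L] differentiable_on_affine[OF _ L] dir_deriv_expand[of f])
qed

text \<open>Each step of the induction replaces the outer function by its derivative. Smoothness is stable
  under this, so only the order of the inner function has to be counted.\<close>

lemma Ck_chain: "smooth g \<Longrightarrow> Ck k f \<Longrightarrow> Ck k (\<lambda>x. g (f x))"
proof (induction k arbitrary: f g)
  case 0
  then show ?case by (auto intro: continuous_on_compose2 smooth_continuous[of g UNIV])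
next
  case (Suc k)
  have g: "g differentiable_on UNIV" "smooth (dir_deriv 1 g)"
    using Suc.prems(1) smooth_iff[of g] by auto
  have "(\<lambda>x. g (f x)) differentiable_on UNIV"
    using g(1) Suc.prems(2) by (auto simp: differentiable_on_def intro!: differentiable_compose[of g f])
  then show ?case
    using Suc.prems(2) g Suc.IH[OF g(2) Ck_SucD[OF Suc.prems(2)]]
    by (auto simp: dir_deriv_chain intro!: Ck_mult)
qed

named_theorems smooth_intros

lemma smooth_const [smooth_intros]: "smooth (\<lambda>x. c)"
  by (simp add: smooth_def Ck_const)

lemma smooth_add [smooth_intros]: "smooth f \<Longrightarrow> smooth g \<Longrightarrow> smooth (\<lambda>x. f x + g x)"
  by (simp add: smooth_def Ck_add)

lemma smooth_mult [smooth_intros]: "smooth f \<Longrightarrow> smooth g \<Longrightarrow> smooth (\<lambda>x. f x * g x)"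
  by (simp add: smooth_def Ck_mult)

lemma smooth_diff [smooth_intros]: 
  assumes "smooth f" "smooth g" shows "smooth (\<lambda>x. f x - g x)"
  using smooth_add[OF assms(1) smooth_mult[OF smooth_const[of "-1"] assms(2)]] by simp

lemma smooth_power [smooth_intros]: "smooth f \<Longrightarrow> smooth (\<lambda>x. f x ^ n)"
  by (induction n) (auto intro: smooth_intros)

lemma smooth_sum [smooth_intros]:
  "finite A \<Longrightarrow> (\<And>j. j \<in> A \<Longrightarrow> smooth (f j)) \<Longrightarrow> smooth (\<lambda>x. \<Sum>j\<in>A. f j x)"
  by (simp add: smooth_def Ck_sum)

lemma smooth_prod [smooth_intros]:
  "finite A \<Longrightarrow> (\<And>j. j \<in> A \<Longrightarrow> smooth (f j)) \<Longrightarrow> smooth (\<lambda>x. \<Prod>j\<in>A. f j x)"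
  by (induction A rule: finite_induct) (auto intro: smooth_const smooth_mult)

lemma smooth_affine: "bounded_linear L \<Longrightarrow> smooth f \<Longrightarrow> smooth (\<lambda>x. f (L x + b))"
  by (simp add: smooth_def Ck_affine)

lemma smooth_chain:
  assumes "smooth g" "smooth f"
  shows "smooth (\<lambda>x. g (f x))"
  unfolding smooth_def[of "\<lambda>x. g (f x)"]
  using Ck_chain[OF assms(1)] assms(2)[unfolded smooth_def] by blast

lemma dir_deriv_inner: "dir_deriv i (\<lambda>x. x \<bullet> p + c) = (\<lambda>x. i \<bullet> p)"
  by (rule dir_deriv_funI) (auto intro!: derivative_eq_intros)

lemma smooth_inner [smooth_intros]: "smooth (\<lambda>x. x \<bullet> p + c)"
  by (subst smooth_iff)
    (simp add: dir_deriv_inner smooth_const bounded_linear_imp_differentiable_on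
      bounded_linear_inner_left)

lemma smooth_norm_sq [smooth_intros]: "smooth (\<lambda>x. (norm (x - a))\<^sup>2)"
proof -
  have "(norm (x - a))\<^sup>2 = (\<Sum>i\<in>Basis. (x \<bullet> i + - (a \<bullet> i))\<^sup>2)" for x
    by (subst dot_square_norm[symmetric], subst euclidean_inner)
       (simp add: power2_eq_square inner_diff_left)
  then show ?thesis by (simp only:) (intro smooth_intros finite_Basis)
qed

lemma dir_deriv_real: 
  fixes f :: "real \<Rightarrow> real"
  assumes "(f has_real_derivative D) (at x)"
  shows "dir_deriv 1 f x = D"
  using dir_deriv_eqI[OF assms[unfolded has_field_derivative_def]] by simp

lemma smooth_real_coinduct:
  fixes f :: "real \<Rightarrow> real"
  assumes "X f"
    and step: "\<And>f. X f \<Longrightarrow> \<exists>g. X g \<and> (\<forall>x. (f has_real_derivative g x) (at x))"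
  shows "smooth f"
proof (rule smooth_coinduct[where X = X, OF assms(1)])
  fix f assume "X f"
  then obtain g where g: "X g" "\<And>x. (f has_real_derivative g x) (at x)" using step by blast
  have "dir_deriv 1 f = g" using dir_deriv_real[OF g(2)] by auto
  moreover have "f differentiable_on UNIV"
    using g(2) unfolding differentiable_on_def real_differentiable_def by blast
  ultimately show "f differentiable_on UNIV \<and> (\<forall>i\<in>Basis. X (dir_deriv i f))" using g(1) by auto
qed

lemma deriv_eq_dir_deriv:
  fixes f :: "real \<Rightarrow> real"
  assumes "smooth f"
  shows "deriv f = dir_deriv 1 f"
proof
  fix x
  obtain D where "(f has_real_derivative D) (at x)"
    using smooth_differentiable[OF assms] unfolding differentiable_on_def
    by (auto simp: real_differentiable_def)
  then show "deriv f x = dir_deriv 1 f x" 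
    using DERIV_imp_deriv dir_deriv_real by metis
qed

lemma smooth_DERIV:
  fixes f :: "real \<Rightarrow> real"
  assumes "smooth f"
  shows "(f has_real_derivative dir_deriv 1 f x) (at x)"
  by (metis assms deriv_eq_dir_deriv DERIV_deriv_iff_real_differentiable differentiable_on_def 
      smooth_differentiable UNIV_I)

lemma dir_deriv_support:
  assumes "closed K" "\<And>x. x \<notin> K \<Longrightarrow> f x = 0" "x \<notin> K"
  shows "dir_deriv i f x = 0"
proof -
  have "((\<lambda>_. 0) has_derivative (\<lambda>_. 0)) (at x)" by simp
  then have "(f has_derivative (\<lambda>_. 0)) (at x)"
    by (rule has_derivative_transform_within_open[where s = "- K"])
      (use assms in \<open>auto simp: open_Compl\<close>)
  then show ?thesis by (simp add: dir_deriv_eqI)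
qed

section \<open>Test functions\<close>

lemma test_functionsI:
  assumes "smooth f" "compact K" "K \<subseteq> S" "\<And>x. x \<notin> K \<Longrightarrow> f x = 0"
  shows "f \<in> test_functions S"
proof -
  have "closure {x. f x \<noteq> 0} \<subseteq> K"
    by (rule closure_minimal) (use assms compact_imp_closed in auto)
  moreover from this have "compact (closure {x. f x \<noteq> 0})"
    using compact_Int_closed[OF assms(2) closed_closure[of "{x. f x \<noteq> 0}"]] by (simp add: Int_absorb1)
  ultimately show ?thesis
    using assms unfolding test_functions_def smooth_def by blast
qed

lemma test_functionsE:
  assumes "f \<in> test_functions S"
  obtains K where "smooth f" "compact K" "K \<subseteq> S" "\<And>x. x \<notin> K \<Longrightarrow> f x = 0"
proof (rule that[of "closure {x. f x \<noteq> 0}"])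
  fix x assume "x \<notin> closure {x. f x \<noteq> 0}"
  then show "f x = 0" using closure_subset[of "{x. f x \<noteq> 0}"] by auto
qed (use assms in \<open>auto simp: test_functions_def smooth_def\<close>)

lemma test_functions_smooth: "f \<in> test_functions S \<Longrightarrow> smooth f"
  by (auto elim: test_functionsE)

lemma test_functions_dir_deriv:
  assumes "f \<in> test_functions S" "i \<in> Basis"
  shows "dir_deriv i f \<in> test_functions S"
  by (rule test_functionsE[OF assms(1)], rule test_functionsI)
     (use assms in \<open>auto intro: smooth_dir_deriv dir_deriv_support compact_imp_closed\<close>)

lemma test_functions_mult:
  assumes "f \<in> test_functions S" "smooth g"
  shows "(\<lambda>x. f x * g x) \<in> test_functions S"
  by (rule test_functionsE[OF assms(1)], rule test_functionsI)
     (use assms in \<open>auto intro: smooth_intros\<close>)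

lemma test_functions_bounded:
  assumes "f \<in> test_functions S"
  obtains B where "B > 0" "\<And>x. \<bar>f x\<bar> \<le> B"
proof -
  obtain K where K: "smooth f" "compact K" "\<And>x. x \<notin> K \<Longrightarrow> f x = 0"
    using assms by (rule test_functionsE) blast
  have "bounded (f ` K)"
    by (intro compact_imp_bounded compact_continuous_image smooth_continuous K)
  then obtain B where "B > 0" "\<And>x. x \<in> K \<Longrightarrow> \<bar>f x\<bar> \<le> B"
    by (auto simp: bounded_pos)
  then show thesis using that[of B] K(3) by force
qed

lemma test_functions_tensor:
  assumes "f \<in> test_functions A" "g \<in> test_functions B"
  shows "(\<lambda>z. f (fst z) * g (snd z)) \<in> test_functions (A \<times> B)"
proof -
  obtain K where K: "smooth f" "compact K" "K \<subseteq> A" "\<And>x. x \<notin> K \<Longrightarrow> f x = 0"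
    using assms(1) by (rule test_functionsE) blast
  obtain M where M: "smooth g" "compact M" "M \<subseteq> B" "\<And>x. x \<notin> M \<Longrightarrow> g x = 0"
    using assms(2) by (rule test_functionsE) blast
  show ?thesis
  proof (rule test_functionsI[where K = "K \<times> M"])
    show "smooth (\<lambda>z. f (fst z) * g (snd z))"
      using smooth_affine[OF bounded_linear_fst K(1), of 0]
        smooth_affine[OF bounded_linear_snd M(1), of 0] by (auto intro: smooth_mult)
  qed (use K M in \<open>auto intro: compact_Times simp: mem_Times_iff\<close>)
qed

lemma smooth_slice_fst: "smooth f \<Longrightarrow> smooth (\<lambda>x. f (x, t))"
  and smooth_slice_snd: "smooth f \<Longrightarrow> smooth (\<lambda>t. f (x, t))"
  using bounded_linear_Pair[OF bounded_linear_ident bounded_linear_zero]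
    bounded_linear_Pair[OF bounded_linear_zero bounded_linear_ident] smooth_affine[of "\<lambda>x. (x, 0)" f "(0, t)"] smooth_affine[of "\<lambda>t. (0, t)" f "(x, 0)"]
  by auto

lemma dir_deriv_slice_fst: "smooth f \<Longrightarrow> dir_deriv i (\<lambda>x. f (x, t)) = (\<lambda>x. dir_deriv (i, 0) f (x, t))"
  and dir_deriv_slice_snd: "smooth f \<Longrightarrow> dir_deriv j (\<lambda>t. f (x, t)) = (\<lambda>t. dir_deriv (0, j) f (x, t))"
  using bounded_linear_Pair[OF bounded_linear_ident bounded_linear_zero]
    bounded_linear_Pair[OF bounded_linear_zero bounded_linear_ident] dir_deriv_affine[of f "\<lambda>x. (x, 0)" i "(0, t)"] dir_deriv_affine[of f "\<lambda>t. (0, t)" j "(x, 0)"]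
  by (auto simp: smooth_differentiable)

lemma test_functions_slice_fst:
  assumes "f \<in> test_functions (A \<times> B)"
  shows "(\<lambda>x. f (x, t)) \<in> test_functions A"
proof (rule test_functionsE[OF assms])
  fix K assume K: "smooth f" "compact K" "K \<subseteq> A \<times> B" "\<And>x. x \<notin> K \<Longrightarrow> f x = 0"
  let ?K = "(\<lambda>x. (x, t)) -` K"
  have "?K = fst ` (K \<inter> (UNIV \<times> {t}))" by force
  moreover have "compact (fst ` (K \<inter> (UNIV \<times> {t})))"
    by (intro compact_continuous_image compact_Int_closed K continuous_intros closed_Times)
  ultimately show ?thesis
    using K by (intro test_functionsI[of _ ?K]) (auto intro: smooth_slice_fst)
qed

section \<open>A smooth bump\<close>

text \<open>The functions \<open>P(1/s) e\<^sup>-\<^sup>1\<^sup>/\<^sup>s\<close>, extended by zero to \<open>s \<le> 0\<close>. All derivatives of the standard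
  flat function \<open>e\<^sup>-\<^sup>1\<^sup>/\<^sup>s\<close>, which is the case \<open>P = 1\<close>, are of this form.\<close>

definition flat :: "real poly \<Rightarrow> real \<Rightarrow> real" where
  "flat P s = (if s > 0 then poly P (1 / s) * exp (- 1 / s) else 0)"

lemma flat_tendsto_0: "(flat P \<longlongrightarrow> 0) (at 0)"
proof -
  have *: "((\<lambda>x::real. x ^ n * exp (- x)) \<longlongrightarrow> 0) at_top" for n
    using tendsto_power_div_exp_0[of n] by (simp add: exp_minus divide_inverse)
  have "((\<lambda>x. poly P x * exp (- x)) \<longlongrightarrow> 0) at_top"
  proof -
    have "((\<lambda>x. \<Sum>i\<le>degree P. coeff P i * (x ^ i * exp (- x))) \<longlongrightarrow> (\<Sum>i\<le>degree P. coeff P i * 0)) at_top"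
      by (intro tendsto_intros *)
    then show ?thesis by (simp add: poly_altdef sum_distrib_right mult.assoc)
  qed
  then have "((\<lambda>s. poly P (inverse s) * exp (- inverse s)) \<longlongrightarrow> 0) (at_right 0)"
    by (rule filterlim_compose) (rule filterlim_inverse_at_top_right)
  then have "(flat P \<longlongrightarrow> 0) (at_right 0)"
    by (rule Lim_transform_eventually)
       (auto simp: flat_def eventually_at_filter inverse_eq_divide)
  moreover have "(flat P \<longlongrightarrow> 0) (at_left 0)"
    by (rule Lim_transform_eventually[OF tendsto_const])
       (auto simp: flat_def eventually_at_filter)
  ultimately show ?thesis by (simp add: filterlim_at_split)
qed

text \<open>At \<open>0\<close> the difference quotient of \<open>P(1/s) e\<^sup>-\<^sup>1\<^sup>/\<^sup>s\<close> is again a function of this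
  kind, for the polynomial \<open>X P\<close>, so it tends to zero.\<close>

lemma flat_DERIV: "(flat P has_real_derivative flat ([:0, 0, 1:] * (P - pderiv P)) s) (at s)"
proof -
  consider "s > 0" | "s = 0" | "s < 0" by linarith
  then show ?thesis
  proof cases
    case 1
    have "((\<lambda>s. poly P (1 / s) * exp (- 1 / s)) has_real_derivative
        flat ([:0, 0, 1:] * (P - pderiv P)) s) (at s)"
      using 1 by (auto intro!: derivative_eq_intros poly_DERIV[THEN DERIV_chain2]
          simp: flat_def field_simps power2_eq_square)
    then show ?thesis
      by (rule has_field_derivative_transform_within_open[where S = "{0<..}"])
         (use 1 in \<open>auto simp: flat_def\<close>)
  next
    case 2
    have "((\<lambda>h. flat P h / h) \<longlongrightarrow> 0) (at 0)"
      using flat_tendsto_0[of "[:0, 1:] * P"] 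
      by (rule Lim_transform_eventually) (auto simp: flat_def eventually_at_filter)
    then show ?thesis using 2 by (simp add: has_field_derivative_iff flat_def)
  next
    case 3
    have "((\<lambda>s. 0) has_real_derivative flat ([:0, 0, 1:] * (P - pderiv P)) s) (at s)"
      using 3 by (simp add: flat_def)
    then show ?thesis
      by (rule has_field_derivative_transform_within_open[where S = "{..<0}"])
         (use 3 in \<open>auto simp: flat_def\<close>)
  qed
qed

lemma smooth_flat: "smooth (flat P)"
  by (rule smooth_real_coinduct[where X = "\<lambda>f. f \<in> range flat"]) (use flat_DERIV in blast)+

text \<open>The scaling makes the height of the bump independent of its radius \<open>r\<close>.\<close>

definition bump :: "'a::euclidean_space \<Rightarrow> real \<Rightarrow> 'a \<Rightarrow> real" where
  "bump a r x = flat 1 (1 - (norm (x - a) / r)\<^sup>2)"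

lemma flat_1_mono: "s \<le> t \<Longrightarrow> flat 1 s \<le> flat 1 t"
  by (auto simp: flat_def frac_le)

lemma bump_bounds: "0 \<le> bump a r x" "bump a r x \<le> 1"
  by (auto simp: bump_def flat_def)

lemma bump_pos_iff: "r > 0 \<Longrightarrow> bump a r x > 0 \<longleftrightarrow> x \<in> ball a r"
  by (auto simp: bump_def flat_def dist_norm norm_minus_commute abs_square_less_1 power_less_one_iff)

lemma smooth_bump: "smooth (bump a r)"
proof -
  have "smooth (\<lambda>x. flat 1 (1 - (1 / r)\<^sup>2 * (norm (x - a))\<^sup>2))"
    by (intro smooth_chain[OF smooth_flat] smooth_intros)
  then show ?thesis by (simp add: bump_def[abs_def] power_divide)
qed

lemma bump_test_function:
  assumes "r > 0" "cball a r \<subseteq> S"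
  shows "bump a r \<in> test_functions S"
proof (rule test_functionsI[where K = "cball a r"])
  fix x assume "x \<notin> cball a r"
  then have "\<not> bump a r x > 0" using bump_pos_iff[OF assms(1), of a x] by auto
  then show "bump a r x = 0" using bump_bounds[of a r x] by linarith
qed (use assms smooth_bump in auto)

section \<open>Smooth approximation of the absolute value\<close>

definition soft_abs :: "nat \<Rightarrow> real \<Rightarrow> real" where
  "soft_abs n s = sqrt (s\<^sup>2 + 1 / Suc n)"

definition soft_sgn :: "nat \<Rightarrow> real \<Rightarrow> real" where
  "soft_sgn n s = s / soft_abs n s"

lemma soft_abs_pos: "soft_abs n s > 0"
  by (simp add: soft_abs_def add_nonneg_pos)

lemma soft_abs_DERIV: "(soft_abs n has_real_derivative soft_sgn n s) (at s)"
proof -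
  have "s\<^sup>2 + 1 / Suc n > 0" by (simp add: add_nonneg_pos)
  moreover have "((\<lambda>s. s\<^sup>2 + 1 / Suc n) has_real_derivative 2 * s) (at s)"
    by (auto intro!: derivative_eq_intros)
  ultimately have "((\<lambda>s. sqrt (s\<^sup>2 + 1 / Suc n)) has_real_derivative
      inverse (sqrt (s\<^sup>2 + 1 / Suc n)) / 2 * (2 * s)) (at s)"
    by (rule DERIV_chain2[OF DERIV_real_sqrt])
  then have "(soft_abs n has_real_derivative inverse (soft_abs n s) / 2 * (2 * s)) (at s)"
    unfolding soft_abs_def[abs_def] .
  then show ?thesis by (rule DERIV_cong) (simp add: soft_sgn_def inverse_eq_divide)
qed

text \<open>The functions \<open>P(s) (s\<^sup>2 + 1/(n+1))\<^sup>a\<close> with \<open>P\<close> a polynomial and \<open>a\<close> a real exponent form a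
  family that is closed under derivatives and contains \<open>soft_abs\<close>.\<close>

lemma smooth_soft_abs: "smooth (soft_abs n)"
proof (rule smooth_real_coinduct[where
      X = "\<lambda>f. \<exists>P a. f = (\<lambda>s. poly P s * (s\<^sup>2 + 1 / Suc n) powr a)"])
  show "\<exists>P a. soft_abs n = (\<lambda>s. poly P s * (s\<^sup>2 + 1 / Suc n) powr a)"
    by (rule exI[of _ 1], rule exI[of _ "1/2"]) 
       (auto simp: soft_abs_def[abs_def] powr_half_sqrt add_nonneg_nonneg)
next
  fix f :: "real \<Rightarrow> real"
  assume "\<exists>P a. f = (\<lambda>s. poly P s * (s\<^sup>2 + 1 / Suc n) powr a)"
  then obtain P a where f: "f = (\<lambda>s. poly P s * (s\<^sup>2 + 1 / Suc n) powr a)" by auto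
  define R where "R = pderiv P * [:1 / Suc n, 0, 1:] + smult (2 * a) ([:0, 1:] * P)"
  have "(f has_real_derivative poly R s * (s\<^sup>2 + 1 / Suc n) powr (a - 1)) (at s)" for s
  proof -
    have pos: "s\<^sup>2 + 1 / Suc n > 0" by (simp add: add_nonneg_pos)
    then have split: "(s\<^sup>2 + 1 / Suc n) powr a = (s\<^sup>2 + 1 / Suc n) * (s\<^sup>2 + 1 / Suc n) powr (a - 1)"
      by (simp add: powr_diff)
    have "(f has_real_derivative poly (pderiv P) s * (s\<^sup>2 + 1 / Suc n) powr a
        + a * (s\<^sup>2 + 1 / Suc n) powr (a - 1) * (2 * s) * poly P s) (at s)"
      unfolding f
      by (rule DERIV_mult'[THEN DERIV_cong, OF poly_DERIV DERIV_fun_powr[of _ "2 * s"]])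
         (use pos in \<open>auto intro!: derivative_eq_intros\<close>)
    then show ?thesis
      unfolding split by (rule DERIV_cong) (simp add: R_def algebra_simps power2_eq_square)
  qed
  then show "\<exists>g. (\<exists>P a. g = (\<lambda>s. poly P s * (s\<^sup>2 + 1 / Suc n) powr a))
      \<and> (\<forall>s. (f has_real_derivative g s) (at s))"
    by blast
qed

lemma dir_deriv_soft_abs: "dir_deriv 1 (soft_abs n) = soft_sgn n"
  using dir_deriv_real[OF soft_abs_DERIV] by auto

lemma soft_abs_bound: "soft_abs n s \<le> \<bar>s\<bar> + 1"
  unfolding soft_abs_def 
  by (rule real_le_lsqrt) (auto simp: power2_sum field_simps intro!: add_nonneg_nonneg)

lemma soft_sgn_bound: "\<bar>soft_sgn n s\<bar> \<le> 1"
proof -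
  have "\<bar>s\<bar> \<le> soft_abs n s" unfolding soft_abs_def by (rule real_le_rsqrt) auto
  then show ?thesis using soft_abs_pos[of n s] by (simp add: soft_sgn_def)
qed

lemma soft_abs_tendsto: "(\<lambda>n. soft_abs n s) \<longlonglongrightarrow> \<bar>s\<bar>"
proof -
  have "(\<lambda>n. 1 / real (Suc n)) \<longlonglongrightarrow> 0" by (rule LIMSEQ_Suc[OF lim_1_over_n])
  then have "(\<lambda>n. sqrt (s\<^sup>2 + 1 / real (Suc n))) \<longlonglongrightarrow> sqrt (s\<^sup>2 + 0)"
    by (intro tendsto_intros)
  then show ?thesis by (simp add: soft_abs_def)
qed

text \<open>The limit holds at \<open>s = 0\<close> too, so the limits of derivatives below hold everywhere and not
  only off the kink.\<close>

lemma soft_sgn_tendsto: "(\<lambda>n. soft_sgn n s) \<longlonglongrightarrow> sgn s"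
proof (cases "s = 0")
  case False
  then have "(\<lambda>n. soft_sgn n s) \<longlonglongrightarrow> s / \<bar>s\<bar>"
    unfolding soft_sgn_def by (intro tendsto_intros soft_abs_tendsto) auto
  then show ?thesis using False by (simp add: sgn_div_norm divide_inverse mult.commute)
qed (simp add: soft_sgn_def)

section \<open>Integration by parts\<close>

lemma set_integral_support:
  fixes f :: "'a \<Rightarrow> real"
  assumes "\<And>x. x \<notin> S \<Longrightarrow> f x = 0"
  shows "(LINT x:S|M. f x) = (LINT x|M. f x)"
  unfolding set_lebesgue_integral_def
  by (rule Bochner_Integration.integral_cong) (auto simp: indicator_def assms)

lemma integrable_indicator_cball:
  "integrable lborel (\<lambda>x::'a::euclidean_space. c * indicator (cball a R) x :: real)"
proof -
  have "emeasure lborel (cball a R) < \<infinity>" by (rule emeasure_bounded_finite) simp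
  then have "integrable lborel (indicator (cball a R) :: 'a \<Rightarrow> real)"
    by (intro integrable_real_indicator) auto
  then show ?thesis by (rule integrable_mult_right)
qed

lemma integrable_bounded_support:
  fixes f :: "'a::euclidean_space \<Rightarrow> real"
  assumes "f \<in> borel_measurable borel" "\<And>x. \<bar>f x\<bar> \<le> B" "bounded K" "\<And>x. x \<notin> K \<Longrightarrow> f x = 0"
  shows "integrable lborel f"
proof -
  obtain R where R: "K \<subseteq> cball 0 R" 
    using bounded_subset_ballD[OF assms(3)] ball_subset_cball by (metis subset_trans)
  show ?thesis
  proof (rule Bochner_Integration.integrable_bound[OF integrable_indicator_cball])
    show "AE x in lborel. norm (f x) \<le> norm (B * indicator (cball 0 R) x)"
    proof (intro AE_I2)
      fix x
      have "B \<ge> 0" using assms(2)[of x] by linarith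
      then show "norm (f x) \<le> norm (B * indicator (cball 0 R) x)"
        using assms(2)[of x] assms(4)[of x] subsetD[OF R, of x] by (cases "x \<in> cball 0 R") auto
    qed
  qed (use assms(1) in simp)
qed

lemma test_function_integrable:
  assumes "f \<in> test_functions S"
  shows "integrable lborel f"
proof -
  obtain B where B: "\<And>x. \<bar>f x\<bar> \<le> B" using test_functions_bounded[OF assms] by blast
  obtain K where "smooth f" "compact K" "\<And>x. x \<notin> K \<Longrightarrow> f x = 0"
    using assms by (rule test_functionsE) blast
  then show ?thesis
    using integrable_bounded_support[of f B K] B by (auto simp: smooth_measurable compact_imp_bounded)
qed

text \<open>Translation invariance makes the integral of every difference quotient vanish, and the
  quotients converge to the derivative under a common bound. This argument is the same in every
  dimension and does not iterate integrals.\<close>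

lemma integral_dir_deriv_test_function:
  assumes f: "f \<in> test_functions S" and i: "i \<in> Basis"
  shows "(LINT x|lborel. dir_deriv i f x) = 0"
proof -
  obtain K where K: "smooth f" "compact K" "\<And>x. x \<notin> K \<Longrightarrow> f x = 0"
    using f by (rule test_functionsE) blast
  obtain R where R: "K \<subseteq> cball 0 R" "R > 0"
    using bounded_subset_ballD[OF compact_imp_bounded[OF K(2)], of 0] ball_subset_cball
    by (metis subset_trans)
  obtain B where B: "B > 0" "\<And>x. \<bar>dir_deriv i f x\<bar> \<le> B"
    using test_functions_bounded[OF test_functions_dir_deriv[OF f i]] by blast
  have line: "((\<lambda>h. f (x + h *\<^sub>R i)) has_real_derivative dir_deriv i f (x + h *\<^sub>R i)) (at h)" for x h
  proof -
    have "((\<lambda>h. x + h *\<^sub>R i) has_derivative (\<lambda>k. k *\<^sub>R i)) (at h)"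
      by (auto intro!: derivative_eq_intros)
    from has_derivative_compose[OF this smooth_has_derivative[OF K(1)]]
    have "((\<lambda>h. f (x + h *\<^sub>R i)) has_derivative
        (\<lambda>k. frechet_derivative f (at (x + h *\<^sub>R i)) (k *\<^sub>R i))) (at h)" .
    moreover have "frechet_derivative f (at y) (k *\<^sub>R i) = dir_deriv i f y * k" for y k
      using linear_frechet_derivative[of f "at y"] smooth_differentiable[OF K(1)]
      by (simp add: dir_deriv_def differentiable_on_def linear_cmul mult.commute)
    ultimately show ?thesis by (simp add: has_field_derivative_def)
  qed
  define q where "q n x = (f (x + (1 / Suc n) *\<^sub>R i) - f x) / (1 / Suc n)" for n x
  have q_bound: "\<bar>q n x\<bar> \<le> B" for n x
  proof -
    obtain z where "f (x + (1 / Suc n) *\<^sub>R i) - f (x + 0 *\<^sub>R i) = (1 / Suc n - 0) * dir_deriv i f (x + z *\<^sub>R i)"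
      using MVT2[of 0 "1 / Suc n" "\<lambda>h. f (x + h *\<^sub>R i)" "\<lambda>h. dir_deriv i f (x + h *\<^sub>R i)"] line
      by auto
    then have "q n x = dir_deriv i f (x + z *\<^sub>R i)" by (simp add: q_def)
    then show ?thesis using B(2) by simp
  qed
  (* The steps 1 / Suc n have length at most 1, which is the extra 1 in the radius. *)
  have q_support: "q n x = 0" if "x \<notin> cball 0 (R + 1)" for n x
  proof -
    have "norm x - 1 \<le> norm (x + (1 / Suc n) *\<^sub>R i)"
    proof -
      have "norm ((1 / Suc n) *\<^sub>R i) \<le> 1" using i by (simp add: field_simps)
      then show ?thesis using norm_diff_ineq[of x "(1 / Suc n) *\<^sub>R i"] by linarith
    qed
    then have "x \<notin> K" "x + (1 / Suc n) *\<^sub>R i \<notin> K" using that R by auto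
    then show ?thesis using K(3) by (simp add: q_def)
  qed
  have meas: "f \<in> borel_measurable borel" "dir_deriv i f \<in> borel_measurable borel"
    using K(1) smooth_dir_deriv[OF K(1) i] by (auto simp: smooth_measurable)
  have q_meas: "q n \<in> borel_measurable borel" for n
    unfolding q_def using meas(1) by measurable
  have int_f: "integrable lborel f" by (rule test_function_integrable[OF f])
  have "(LINT x|lborel. q n x) = 0" for n
  proof -
    let ?c = "(1 / Suc n) *\<^sub>R i"
    have distr: "distr lborel borel ((+) ?c) = (lborel :: 'a measure)" by (rule lborel_distr_plus)
    have "integrable lborel (\<lambda>x. f (?c + x))"
      using int_f integrable_distr_eq[of "(+) ?c" lborel borel f] meas(1) distr by simp
    moreover have "(LINT x|lborel. f (?c + x)) = (LINT x|lborel. f x)"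
      using integral_distr[of "(+) ?c" lborel borel f] meas(1) distr by simp
    ultimately show ?thesis using int_f by (simp add: q_def add.commute)
  qed
  moreover have "(\<lambda>n. LINT x|lborel. q n x) \<longlonglongrightarrow> (LINT x|lborel. dir_deriv i f x)"
  proof (rule integral_dominated_convergence[where w = "\<lambda>x. B * indicator (cball 0 (R + 1)) x"])
    show "integrable lborel (\<lambda>x::'a. B * indicator (cball 0 (R + 1)) x)"
      by (rule integrable_indicator_cball)
    show "AE x in lborel. (\<lambda>n. q n x) \<longlonglongrightarrow> dir_deriv i f x"
    proof (intro AE_I2)
      fix x
      have "filterlim (\<lambda>n. 1 / real (Suc n)) (at 0) sequentially"
        by (rule filterlim_atI[OF LIMSEQ_Suc[OF lim_1_over_n]]) auto
      moreover have "((\<lambda>h. (f (x + h *\<^sub>R i) - f x) / h) \<longlongrightarrow> dir_deriv i f x) (at 0)"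
        using line[of x 0] by (simp add: has_field_derivative_iff)
      ultimately show "(\<lambda>n. q n x) \<longlonglongrightarrow> dir_deriv i f x"
        unfolding q_def by (rule filterlim_compose[rotated])
    qed
    show "AE x in lborel. norm (q n x) \<le> B * indicator (cball 0 (R + 1)) x" for n
      using q_bound q_support by (auto simp: indicator_def intro!: AE_I2)
  qed (use meas q_meas in auto)
  ultimately show ?thesis by (simp add: LIMSEQ_const_iff)
qed

lemma integration_by_parts:
  assumes u: "smooth u" and \<phi>: "\<phi> \<in> test_functions S" and i: "i \<in> Basis"
  shows "(LINT x:S|lborel. u x * dir_deriv i \<phi> x) = - (LINT x:S|lborel. dir_deriv i u x * \<phi> x)"
proof -
  have "0 = (LINT x|lborel. dir_deriv i (\<lambda>x. \<phi> x * u x) x)"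
    using integral_dir_deriv_test_function[OF test_functions_mult[OF \<phi> u] i] by simp
  also have "\<dots> = (LINT x|lborel. \<phi> x * dir_deriv i u x + dir_deriv i \<phi> x * u x)"
    using u \<phi> by (subst dir_deriv_mult) (auto intro: smooth_differentiable test_functions_smooth)
  also have "\<dots> = (LINT x|lborel. \<phi> x * dir_deriv i u x) + (LINT x|lborel. dir_deriv i \<phi> x * u x)"
    using test_function_integrable[OF test_functions_mult[OF \<phi> smooth_dir_deriv[OF u i]]]
      test_function_integrable[OF test_functions_mult[OF test_functions_dir_deriv[OF \<phi> i] u]]
    by (rule Bochner_Integration.integral_add)
  finally have "(LINT x|lborel. u x * dir_deriv i \<phi> x) = - (LINT x|lborel. dir_deriv i u x * \<phi> x)"
    by (simp add: mult.commute)
  moreover have "\<phi> x = 0" "dir_deriv i \<phi> x = 0" if "x \<notin> S" for x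
    using \<phi> test_functions_dir_deriv[OF \<phi> i] that
    by (auto elim!: test_functionsE)
  ultimately show ?thesis by (simp add: set_integral_support)
qed

section \<open>Square integrable functions\<close>

lemma L2_mult_integrable:
  assumes "f \<in> L2 S" "g \<in> L2 S"
  shows "set_integrable lborel S (\<lambda>x. f x * g x)"
proof -
  have "integrable lborel (\<lambda>x. indicator S x *\<^sub>R (f x)\<^sup>2 + indicator S x *\<^sub>R (g x)\<^sup>2)"
    using assms by (auto simp: L2_def set_integrable_def)
  then show ?thesis unfolding set_integrable_def
  proof (rule Bochner_Integration.integrable_bound)
    have [measurable]: "(\<lambda>x. indicator S x *\<^sub>R f x) \<in> borel_measurable lborel"
      "(\<lambda>x. indicator S x *\<^sub>R g x) \<in> borel_measurable lborel"
      using assms by (auto simp: L2_def set_borel_measurable_def)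
    have "(\<lambda>x. (indicator S x *\<^sub>R f x) * (indicator S x *\<^sub>R g x)) \<in> borel_measurable lborel"
      by (rule borel_measurable_times) measurable
    also have "(\<lambda>x. (indicator S x *\<^sub>R f x) * (indicator S x *\<^sub>R g x))
        = (\<lambda>x. indicator S x *\<^sub>R (f x * g x))"
      by (auto simp: indicator_def)
    finally show "(\<lambda>x. indicator S x *\<^sub>R (f x * g x)) \<in> borel_measurable lborel" .
    have "\<bar>a * b\<bar> \<le> a\<^sup>2 + b\<^sup>2" for a b :: real
      using sum_squares_bound[of "\<bar>a\<bar>" "\<bar>b\<bar>"] mult_nonneg_nonneg[of "\<bar>a\<bar>" "\<bar>b\<bar>"]
      unfolding abs_mult power2_abs by linarith
    then show "AE x in lborel. norm (indicator S x *\<^sub>R (f x * g x))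
        \<le> norm (indicator S x *\<^sub>R (f x)\<^sup>2 + indicator S x *\<^sub>R (g x)\<^sup>2)"
      by (auto simp: indicator_def)
  qed
qed

lemma L2_lincomb:
  assumes "f \<in> L2 S" "g \<in> L2 S"
  shows "(\<lambda>x. a * f x + b * g x) \<in> L2 S"
proof -
  have [measurable]: "(\<lambda>x. indicator S x *\<^sub>R f x) \<in> borel_measurable lborel"
    "(\<lambda>x. indicator S x *\<^sub>R g x) \<in> borel_measurable lborel"
    using assms by (auto simp: L2_def set_borel_measurable_def)
  have "(\<lambda>x. a * (indicator S x *\<^sub>R f x) + b * (indicator S x *\<^sub>R g x)) \<in> borel_measurable lborel"
    by measurable
  then have 1: "set_borel_measurable lborel S (\<lambda>x. a * f x + b * g x)"
    unfolding set_borel_measurable_def by (simp add: algebra_simps)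
  have "set_integrable lborel S (\<lambda>x. a\<^sup>2 * (f x)\<^sup>2 + (2 * a * b) * (f x * g x) + b\<^sup>2 * (g x)\<^sup>2)"
    using assms L2_mult_integrable[OF assms] by (intro set_integral_add(1) set_integrable_mult_right) (auto simp: L2_def)
  also have "(\<lambda>x. a\<^sup>2 * (f x)\<^sup>2 + (2 * a * b) * (f x * g x) + b\<^sup>2 * (g x)\<^sup>2) = (\<lambda>x. (a * f x + b * g x)\<^sup>2)"
    by (auto simp: power2_eq_square algebra_simps)
  finally show ?thesis using 1 by (simp add: L2_def)
qed

lemma L2_diff: "f \<in> L2 S \<Longrightarrow> g \<in> L2 S \<Longrightarrow> (\<lambda>x. f x - g x) \<in> L2 S"
  using L2_lincomb[of f S g 1 "-1"] by simp

lemma set_integral_square_nonneg: "0 \<le> (LINT x:S|lborel. (f x)\<^sup>2 :: real)"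
  by (simp add: set_lebesgue_integral_def)

lemma L2_norm_nonneg: "0 \<le> L2_norm S f"
  by (simp add: L2_norm_def set_integral_square_nonneg)

lemma L2_Cauchy_Schwarz:
  assumes f: "f \<in> L2 S" and g: "g \<in> L2 S"
  shows "\<bar>LINT x:S|lborel. f x * g x\<bar> \<le> L2_norm S f * L2_norm S g"
proof -
  define A where "A = (LINT x:S|lborel. (f x)\<^sup>2)"
  define B where "B = (LINT x:S|lborel. (g x)\<^sup>2)"
  define C where "C = (LINT x:S|lborel. f x * g x)"
  have nn: "A \<ge> 0" "B \<ge> 0" by (auto simp: A_def B_def set_integral_square_nonneg)
  have quad: "0 \<le> a\<^sup>2 * A + 2 * a * b * C + b\<^sup>2 * B" for a b
  proof -
    have "0 \<le> (LINT x:S|lborel. (a * f x + b * g x)\<^sup>2)" by (rule set_integral_square_nonneg)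
    also have "\<dots> = (LINT x:S|lborel. a\<^sup>2 * (f x)\<^sup>2 + (2 * a * b) * (f x * g x) + b\<^sup>2 * (g x)\<^sup>2)"
      by (auto simp: power2_eq_square algebra_simps)
    also have "\<dots> = a\<^sup>2 * A + 2 * a * b * C + b\<^sup>2 * B"
      using f g L2_mult_integrable[OF f g]
      by (subst set_integral_add set_integral_mult_right,
          (auto simp: L2_def A_def B_def C_def mult.assoc)[2])+ 
         (simp add: A_def B_def C_def)
    finally show ?thesis .
  qed
  (* Discriminant argument without division: both A and B times (A * B - C^2) are
     nonnegative, and A + B > 0 unless both norms vanish. *)
  have "C\<^sup>2 \<le> A * B"
  proof (cases "A = 0 \<and> B = 0")
    case True
    then show ?thesis using quad[of 1 1] quad[of 1 "-1"] by auto
  next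
    case False
    then have "A + B > 0" using nn by linarith
    have "0 \<le> B * (A * B - C\<^sup>2)" using quad[of B "- C"] by (simp add: power2_eq_square algebra_simps)
    moreover have "0 \<le> A * (A * B - C\<^sup>2)" using quad[of "- C" A] by (simp add: power2_eq_square algebra_simps)
    ultimately have "0 \<le> (A + B) * (A * B - C\<^sup>2)" by (simp add: algebra_simps)
    then show ?thesis using \<open>A + B > 0\<close> by (simp add: zero_le_mult_iff)
  qed
  then have "sqrt (C\<^sup>2) \<le> sqrt (A * B)" by (rule real_sqrt_le_mono)
  then show ?thesis by (simp add: L2_norm_def A_def B_def C_def real_sqrt_mult)
qed

lemma set_borel_measurableI:
  fixes f :: "'a::euclidean_space \<Rightarrow> real"
  shows "f \<in> borel_measurable borel \<Longrightarrow> S \<in> sets borel \<Longrightarrow> set_borel_measurable lborel S f"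
  unfolding set_borel_measurable_def by simp

lemma set_integrable_const_bounded:
  fixes S :: "'a::euclidean_space set"
  assumes "S \<in> sets borel" "bounded S"
  shows "set_integrable lborel S (\<lambda>x. c :: real)"
  unfolding set_integrable_def
  using emeasure_bounded_finite[OF assms(2)] assms(1)
  by (auto intro!: integrable_mult_left integrable_real_indicator)

lemma L2I_bounded:
  assumes "S \<in> sets borel" "bounded S" "f \<in> borel_measurable borel" "\<And>x. x \<in> S \<Longrightarrow> \<bar>f x\<bar> \<le> B"
  shows "f \<in> L2 S"
proof -
  have "set_integrable lborel S (\<lambda>x. (f x)\<^sup>2)"
  proof (rule set_integrable_bound[OF set_integrable_const_bounded[OF assms(1,2), of "B\<^sup>2"]])
    show "AE x in lborel. x \<in> S \<longrightarrow> norm ((f x)\<^sup>2) \<le> norm (B\<^sup>2)"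
      using power_mono[OF assms(4) abs_ge_zero, of _ 2] by (auto intro!: AE_I2)
  qed (use assms in \<open>auto intro!: set_borel_measurableI\<close>)
  then show ?thesis using assms by (simp add: L2_def set_borel_measurableI)
qed

lemma L2_integrable:
  assumes "S \<in> sets borel" "bounded S" "f \<in> L2 S"
  shows "set_integrable lborel S f"
  using L2_mult_integrable[OF assms(3) L2I_bounded[OF assms(1,2), of "\<lambda>x. 1" 1]] by simp

lemma set_integral_dominated_convergence:
  fixes f :: "'a::euclidean_space \<Rightarrow> real"
  assumes "set_integrable lborel S w"
    and "\<And>n. set_borel_measurable lborel S (s n)" "set_borel_measurable lborel S f"
    and "AE x\<in>S in lborel. (\<lambda>n. s n x) \<longlonglongrightarrow> f x"
    and "\<And>n. AE x\<in>S in lborel. \<bar>s n x\<bar> \<le> w x"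
  shows "(\<lambda>n. LINT x:S|lborel. s n x) \<longlonglongrightarrow> (LINT x:S|lborel. f x)"
  unfolding set_lebesgue_integral_def
proof (rule integral_dominated_convergence[where w = "\<lambda>x. indicator S x *\<^sub>R w x"])
  show "AE x in lborel. (\<lambda>n. indicator S x *\<^sub>R s n x) \<longlonglongrightarrow> indicator S x *\<^sub>R f x"
    using assms(4) by eventually_elim (auto simp: indicator_def)
  show "AE x in lborel. norm (indicator S x *\<^sub>R s n x) \<le> indicator S x *\<^sub>R w x" for n
    using assms(5)[of n] by eventually_elim (auto simp: indicator_def)
qed (use assms in \<open>auto simp: set_integrable_def set_borel_measurable_def\<close>)

lemma set_integral_bounded_convergence:
  fixes f w :: "'a::euclidean_space \<Rightarrow> real"
  assumes S: "S \<in> sets borel" and w: "set_integrable lborel S w"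
    and s: "\<And>n. s n \<in> borel_measurable borel" and f: "f \<in> borel_measurable borel"
    and lim: "AE x\<in>S in lborel. (\<lambda>n. s n x) \<longlonglongrightarrow> f x"
    and bound: "\<And>n x. x \<in> S \<Longrightarrow> \<bar>s n x\<bar> \<le> B"
  shows "(\<lambda>n. LINT x:S|lborel. s n x * w x) \<longlonglongrightarrow> (LINT x:S|lborel. f x * w x)"
proof (rule set_integral_dominated_convergence[where w = "\<lambda>x. B * \<bar>w x\<bar>"])
  show "set_integrable lborel S (\<lambda>x. B * \<bar>w x\<bar>)" using set_integrable_abs[OF w] by simp
  have "(\<lambda>x. g x * (indicator S x *\<^sub>R w x)) \<in> borel_measurable lborel"
    if "g \<in> borel_measurable borel" for g
    using that w by (intro borel_measurable_times) (auto simp: set_integrable_def)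
  moreover have "(\<lambda>x. g x * (indicator S x *\<^sub>R w x)) = (\<lambda>x. indicator S x *\<^sub>R (g x * w x))" for g
    by (simp add: fun_eq_iff)
  ultimately show "set_borel_measurable lborel S (\<lambda>x. s n x * w x)"
    "set_borel_measurable lborel S (\<lambda>x. f x * w x)" for n
    using s f by (simp_all add: set_borel_measurable_def)
  show "AE x\<in>S in lborel. (\<lambda>n. s n x * w x) \<longlonglongrightarrow> f x * w x"
    using lim by eventually_elim (auto intro: tendsto_mult)
  show "AE x\<in>S in lborel. \<bar>s n x * w x\<bar> \<le> B * \<bar>w x\<bar>" for n
    using bound by (auto simp: abs_mult intro!: AE_I2 mult_right_mono)
qed

text \<open>Dominated convergence in \<open>L\<^sup>2\<close>, for the approximation in \<open>H\<^sup>1\<close> and the continuity in time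
  below.\<close>

lemma L2_norm_tendsto_0:
  assumes S: "S \<in> sets borel" "bounded S"
    and s: "\<And>n. s n \<in> borel_measurable borel"
    and lim: "AE x\<in>S in lborel. (\<lambda>n. s n x) \<longlonglongrightarrow> 0"
    and bound: "\<And>n x. x \<in> S \<Longrightarrow> \<bar>s n x\<bar> \<le> B"
  shows "(\<lambda>n. L2_norm S (s n)) \<longlonglongrightarrow> 0"
proof -
  have "(\<lambda>n. LINT x:S|lborel. (s n x)\<^sup>2 * 1) \<longlonglongrightarrow> (LINT x:S|lborel. 0 * 1)"
  proof (rule set_integral_bounded_convergence[where B = "B\<^sup>2"])
    show "AE x\<in>S in lborel. (\<lambda>n. (s n x)\<^sup>2) \<longlonglongrightarrow> 0"
      using lim by eventually_elim (auto intro: tendsto_eq_intros)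
    show "\<bar>(s n x)\<^sup>2\<bar> \<le> B\<^sup>2" if "x \<in> S" for n x
      using power_mono[OF bound[OF that, of n] abs_ge_zero, of 2] by simp
  qed (use S s in \<open>auto intro: set_integrable_const_bounded\<close>)
  then have "(\<lambda>n. sqrt (LINT x:S|lborel. (s n x)\<^sup>2)) \<longlonglongrightarrow> sqrt 0"
    by (intro tendsto_real_sqrt) simp
  then show ?thesis by (simp add: L2_norm_def)
qed

section \<open>The fundamental lemma of the calculus of variations\<close>

text \<open>The integral of \<open>k\<close> vanishes over every open subset of \<open>S\<close>, because the indicator function of an
  open set is a bounded limit of test functions. Open sets generate the Borel sets and are closed
  under intersection, so the integral over every Borel set vanishes.\<close>

lemma fundamental_lemma:
  fixes S :: "'a::euclidean_space set"
  assumes S: "open S" and k: "set_integrable lborel S k"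
    and zero: "\<And>\<phi>. \<phi> \<in> test_functions S \<Longrightarrow> (LINT x:S|lborel. k x * \<phi> x) = 0"
  shows "AE x\<in>S in lborel. k x = 0"
proof -
  define K where "K x = indicator S x *\<^sub>R k x" for x
  have K: "integrable lborel K" using k by (simp add: K_def[abs_def] set_integrable_def)
  have K_test: "(LINT x|lborel. K x * \<phi> x) = 0" if "\<phi> \<in> test_functions S" for \<phi>
    using zero[OF that] by (simp add: K_def set_lebesgue_integral_def mult.assoc)
  have K_open: "(LINT x:U|lborel. K x) = 0" if "open U" for U
  proof (cases "U \<inter> S = {}")
    case True
    then have "(\<lambda>x. indicator U x *\<^sub>R K x) = (\<lambda>x. 0)"
      by (auto simp: K_def indicator_def fun_eq_iff)
    then show ?thesis by (simp only: set_lebesgue_integral_def Bochner_Integration.integral_zero)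
  next
    case False
    define V where "V = U \<inter> S"
    have V: "open V" "V \<noteq> {}" "V \<subseteq> S" using that S False by (auto simp: V_def)
    define F where "F = {ball a r | a r. r > 0 \<and> cball a r \<subseteq> V}"
    have "\<Union>F = V"
    proof (intro equalityI subsetI)
      fix x assume "x \<in> V"
      then obtain e where "e > 0" "cball x e \<subseteq> V" using V(1) open_contains_cball by metis
      then show "x \<in> \<Union>F" by (intro UnionI[of "ball x e"]) (auto simp: F_def)
    next
      fix x assume "x \<in> \<Union>F"
      then obtain a r where "x \<in> ball a r" "cball a r \<subseteq> V" by (auto simp: F_def)
      then show "x \<in> V" using ball_subset_cball[of a r] by blast
    qed
    obtain F' where F': "F' \<subseteq> F" "countable F'" "\<Union>F' = V"
      by (rule Lindelof[of F]) (use \<open>\<Union>F = V\<close> in \<open>auto simp: F_def\<close>)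
    then have "F' \<noteq> {}" using V(2) by auto
    define b where "b = from_nat_into F'"
    have "range b = F'" using F'(2) \<open>F' \<noteq> {}\<close> by (simp add: b_def)
    then have "b n \<in> F" for n using F'(1) by auto
    then have "\<forall>n. \<exists>a r. b n = ball a r \<and> r > 0 \<and> cball a r \<subseteq> V"
      unfolding F_def mem_Collect_eq by blast
    then obtain a r where ar: "\<And>n. b n = ball (a n) (r n)" "\<And>n. r n > 0" "\<And>n. cball (a n) (r n) \<subseteq> V"
      by metis
    have V_eq: "V = (\<Union>n. ball (a n) (r n))" using F'(3) \<open>range b = F'\<close> ar(1) by auto
    define \<beta> where "\<beta> n = bump (a n) (r n)" for n
    have \<beta>: "0 \<le> \<beta> n x" "\<beta> n x \<le> 1" "\<beta> n x > 0 \<longleftrightarrow> x \<in> ball (a n) (r n)" for n x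
      unfolding \<beta>_def by (fact bump_bounds bump_pos_iff[OF ar(2)])+
    have \<beta>_out: "\<beta> n x = 0" if "x \<notin> V" for n x
      using \<beta>(1,3)[of n x] that V_eq by (metis UN_I UNIV_I less_eq_real_def)
    (* A point of V lies in some ball m, where 1 - \<beta> m < 1, so the N-th power pushes the
       product to 0; off V every factor is 1. Each product has finitely many factors, which
       keeps the support compact. *)
    define \<Phi> where "\<Phi> N x = 1 - (\<Prod>n<N. (1 - \<beta> n x) ^ N)" for N x
    have \<Phi>_bounds: "0 \<le> \<Phi> N x" "\<Phi> N x \<le> 1" for N x
      using \<beta>(1,2) by (auto simp: \<Phi>_def intro!: prod_le_1 prod_nonneg power_le_one)
    have \<Phi>_smooth: "smooth (\<Phi> N)" for N
      unfolding \<Phi>_def[abs_def] \<beta>_def by (intro smooth_intros smooth_bump) auto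
    have "\<Phi> N \<in> test_functions S" for N
    proof (rule test_functionsI[where K = "\<Union>n<N. cball (a n) (r n)"])
      fix x assume "x \<notin> (\<Union>n<N. cball (a n) (r n))"
      then have "\<beta> n x = 0" if "n < N" for n
        using \<beta>(1,3)[of n x] that ball_subset_cball[of "a n" "r n"] 
        by (metis UN_I lessThan_iff less_eq_real_def subsetD)
      then show "\<Phi> N x = 0" by (simp add: \<Phi>_def)
    qed (use \<Phi>_smooth ar(3) V(3) in \<open>auto intro!: compact_UN\<close>)
    then have "(LINT x|lborel. K x * \<Phi> N x) = 0" for N by (rule K_test)
    moreover have "(\<lambda>N. LINT x|lborel. K x * \<Phi> N x) \<longlonglongrightarrow> (LINT x|lborel. K x * indicator V x)"
    proof (rule integral_dominated_convergence[where w = "\<lambda>x. \<bar>K x\<bar>"])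
      have "(\<lambda>N. \<Phi> N x) \<longlonglongrightarrow> indicator V x" for x
      proof (cases "x \<in> V")
        case True
        then obtain m where m: "x \<in> ball (a m) (r m)" using V_eq by auto
        have c: "0 \<le> 1 - \<beta> m x" "1 - \<beta> m x < 1" using \<beta>[of m x] m by auto
        have "(\<lambda>N. \<Prod>n<N. (1 - \<beta> n x) ^ N) \<longlonglongrightarrow> 0"
        proof (rule tendsto_sandwich[OF _ _ tendsto_const])
          show "(\<lambda>N. (1 - \<beta> m x) ^ N) \<longlonglongrightarrow> 0" using c by (intro LIMSEQ_realpow_zero)
          show "\<forall>\<^sub>F N in sequentially. 0 \<le> (\<Prod>n<N. (1 - \<beta> n x) ^ N)"
            using \<beta>(2) by (auto intro!: always_eventually prod_nonneg)
          show "\<forall>\<^sub>F N in sequentially. (\<Prod>n<N. (1 - \<beta> n x) ^ N) \<le> (1 - \<beta> m x) ^ N"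
            using eventually_gt_at_top[of m]
          proof eventually_elim
            fix N assume "m < N"
            then have "(\<Prod>n<N. (1 - \<beta> n x) ^ N) 
                = (1 - \<beta> m x) ^ N * (\<Prod>n\<in>{..<N} - {m}. (1 - \<beta> n x) ^ N)"
              by (intro prod.remove) auto
            also have "\<dots> \<le> (1 - \<beta> m x) ^ N * 1"
              using c \<beta>(1,2) by (intro mult_left_mono prod_le_1) (auto intro: power_le_one)
            finally show "(\<Prod>n<N. (1 - \<beta> n x) ^ N) \<le> (1 - \<beta> m x) ^ N" by simp
          qed
        qed
        then have "(\<lambda>N. \<Phi> N x) \<longlonglongrightarrow> 1 - 0" unfolding \<Phi>_def by (intro tendsto_intros)
        then show ?thesis using True by simp
      next
        case False
        then show ?thesis by (simp add: \<Phi>_def \<beta>_out)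
      qed
      then show "AE x in lborel. (\<lambda>N. K x * \<Phi> N x) \<longlonglongrightarrow> K x * indicator V x"
        by (intro AE_I2 tendsto_mult tendsto_const)
      show "AE x in lborel. norm (K x * \<Phi> N x) \<le> \<bar>K x\<bar>" for N
        using \<Phi>_bounds by (auto simp: abs_mult intro!: AE_I2 mult_left_le)
      show "(\<lambda>x. K x * \<Phi> N x) \<in> borel_measurable lborel" for N
        using K smooth_measurable[OF \<Phi>_smooth[of N]] by (intro borel_measurable_times) auto
      show "(\<lambda>x. K x * indicator V x) \<in> borel_measurable lborel"
        using K V(1) by (intro borel_measurable_times) auto
    qed (use K in auto)
    ultimately have "(LINT x|lborel. K x * indicator V x) = 0" by (simp add: LIMSEQ_const_iff)
    also have "(\<lambda>x. K x * indicator V x) = (\<lambda>x. indicator U x *\<^sub>R K x)"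
      by (auto simp: K_def V_def indicator_def)
    finally show ?thesis by (simp add: set_lebesgue_integral_def)
  qed
  have K_borel: "(LINT x:A|lborel. K x) = 0" if "A \<in> sets lborel" for A
  proof -
    have K_on: "set_integrable lborel A K" if "A \<in> sets borel" for A
      unfolding set_integrable_def by (rule integrable_mult_indicator) (use K that in auto)
    have "Int_stable {S :: 'a set. open S}" "{S :: 'a set. open S} \<subseteq> Pow UNIV"
      "A \<in> sigma_sets UNIV {S. open S}"
      using that by (auto simp: Int_stable_def borel_def)
    then show ?thesis
    proof (induction rule: sigma_sets_induct_disjoint)
      case (compl A)
      then have A: "A \<in> sets borel" by (simp add: borel_def)
      then have "(LINT x:A \<union> - A|lborel. K x) = (LINT x:A|lborel. K x) + (LINT x:- A|lborel. K x)"
        by (intro set_integral_Un K_on) auto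
      then show ?case using compl K_open[of UNIV] by (simp add: Compl_eq_Diff_UNIV)
    next
      case (union A)
      then have A: "A i \<in> sets borel" for i by (auto simp: borel_def)
      have "(LINT x:(\<Union>i. A i)|lborel. K x) = (\<Sum>i. LINT x:A i|lborel. K x)"
        using union(1) A K_on[of "\<Union>i. A i"]
        by (intro lebesgue_integral_countable_add) (auto simp: disjoint_family_on_def)
      then show ?case using union by simp
    qed (use K_open in \<open>auto simp: set_lebesgue_integral_def\<close>)
  qed
  have "AE x in lborel. K x = 0" 
    using K K_borel by (rule sigma_finite_measure.density_zero[OF sigma_finite_lborel])
  then show ?thesis by eventually_elim (auto simp: K_def)
qed

section \<open>Weak derivatives\<close>

lemma continuous_bounded_on:
  fixes f :: "'a::euclidean_space \<Rightarrow> real"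
  assumes "continuous_on UNIV f" "bounded S"
  obtains B where "B \<ge> 0" "\<And>x. x \<in> S \<Longrightarrow> \<bar>f x\<bar> \<le> B"
proof -
  have "compact (f ` closure S)"
    using assms by (intro compact_continuous_image) (auto intro: continuous_on_subset simp: compact_closure)
  then obtain B where "B > 0" "\<And>y. y \<in> f ` closure S \<Longrightarrow> norm y \<le> B"
    using compact_imp_bounded bounded_pos by metis
  then show thesis using closure_subset[of S] by (intro that[of B]) auto
qed

lemma smooth_L2:
  assumes "smooth u" "S \<in> sets borel" "bounded S"
  shows "u \<in> L2 S"
proof -
  obtain B where "\<And>x. x \<in> S \<Longrightarrow> \<bar>u x\<bar> \<le> B"
    using continuous_bounded_on[OF smooth_continuous[OF assms(1)] assms(3)] by metis
  then show ?thesis using assms by (intro L2I_bounded[where B = B]) (auto simp: smooth_measurable)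
qed

lemma test_function_L2:
  "\<phi> \<in> test_functions S' \<Longrightarrow> S \<in> sets borel \<Longrightarrow> bounded S \<Longrightarrow> \<phi> \<in> L2 S"
  by (simp add: smooth_L2 test_functions_smooth)

lemma L2_norm_cong_AE:
  assumes "f \<in> L2 S" "g \<in> L2 S" "AE x\<in>S in lborel. f x = g x"
  shows "L2_norm S f = L2_norm S g"
proof -
  have "(LINT x:S|lborel. (f x)\<^sup>2) = (LINT x:S|lborel. (g x)\<^sup>2)"
    unfolding set_lebesgue_integral_def
  proof (rule integral_cong_AE)
    show "AE x in lborel. indicator S x *\<^sub>R (f x)\<^sup>2 = indicator S x *\<^sub>R (g x)\<^sup>2"
      using assms(3) by eventually_elim (auto simp: indicator_def)
  qed (use assms in \<open>auto simp: L2_def set_integrable_def\<close>)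
  then show ?thesis by (simp add: L2_norm_def)
qed

lemma has_weak_deriv_unique:
  assumes S: "open S" "bounded S" and "has_weak_deriv S i u g" "has_weak_deriv S i u h"
  shows "AE x\<in>S in lborel. g x = h x"
proof -
  have L2: "g \<in> L2 S" "h \<in> L2 S" using assms by (auto simp: has_weak_deriv_def)
  have borel: "S \<in> sets borel" using S by simp
  have "AE x\<in>S in lborel. g x - h x = 0"
  proof (rule fundamental_lemma[OF S(1)])
    show "set_integrable lborel S (\<lambda>x. g x - h x)"
      by (intro L2_integrable borel S L2_diff L2)
    fix \<phi> assume \<phi>: "\<phi> \<in> test_functions S"
    have "(LINT x:S|lborel. g x * \<phi> x) = (LINT x:S|lborel. h x * \<phi> x)"
      using assms \<phi> unfolding has_weak_deriv_def by (metis neg_equal_iff_equal)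
    moreover have "(LINT x:S|lborel. g x * \<phi> x - h x * \<phi> x)
        = (LINT x:S|lborel. g x * \<phi> x) - (LINT x:S|lborel. h x * \<phi> x)"
      by (intro set_integral_diff L2_mult_integrable L2 test_function_L2[OF \<phi> borel S(2)])
    ultimately show "(LINT x:S|lborel. (g x - h x) * \<phi> x) = 0"
      by (simp add: left_diff_distrib)
  qed
  then show ?thesis by simp
qed

text \<open>The \<open>H\<^sup>1\<close>-norm is defined with a choice of weak derivatives; by uniqueness any choice gives the
  same value.\<close>

lemma H1_norm_eq:
  assumes S: "open S" "bounded S" and G: "\<And>i. i \<in> Basis \<Longrightarrow> has_weak_deriv S i u (G i)"
  shows "H1_norm S u = sqrt ((L2_norm S u)\<^sup>2 + (\<Sum>i\<in>Basis. (L2_norm S (G i))\<^sup>2))"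
proof -
  have "L2_norm S (weak_deriv S i u) = L2_norm S (G i)" if "i \<in> Basis" for i
  proof -
    have "has_weak_deriv S i u (weak_deriv S i u)"
      unfolding weak_deriv_def using G[OF that] by (rule someI[of "has_weak_deriv S i u"])
    then show ?thesis
      using has_weak_deriv_unique[OF S _ G[OF that]] G[OF that]
      by (intro L2_norm_cong_AE) (auto simp: has_weak_deriv_def)
  qed
  then show ?thesis by (simp add: H1_norm_def)
qed

lemma L2_norm_le_H1_norm: "L2_norm S u \<le> H1_norm S u"
  unfolding H1_norm_def by (rule real_le_rsqrt) (simp add: sum_nonneg)

lemma has_weak_deriv_diff:
  assumes S: "S \<in> sets borel" "bounded S" and i: "i \<in> Basis"
    and u: "has_weak_deriv S i u g" and v: "has_weak_deriv S i v h"
  shows "has_weak_deriv S i (\<lambda>x. u x - v x) (\<lambda>x. g x - h x)"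
proof -
  have L2: "u \<in> L2 S" "g \<in> L2 S" "v \<in> L2 S" "h \<in> L2 S"
    using u v by (auto simp: has_weak_deriv_def)
  have diff: "(LINT x:S|lborel. (f x - k x) * \<psi> x)
      = (LINT x:S|lborel. f x * \<psi> x) - (LINT x:S|lborel. k x * \<psi> x)"
    if "f \<in> L2 S" "k \<in> L2 S" "\<psi> \<in> test_functions S" for f k \<psi>
    unfolding left_diff_distrib
    by (intro set_integral_diff L2_mult_integrable that test_function_L2[OF that(3) S])
  show ?thesis
    unfolding has_weak_deriv_def
  proof (intro conjI ballI L2_diff L2)
    fix \<phi> assume \<phi>: "\<phi> \<in> test_functions S"
    then show "(LINT x:S|lborel. (u x - v x) * dir_deriv i \<phi> x)
        = - (LINT x:S|lborel. (g x - h x) * \<phi> x)"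
      using u v by (simp add: diff L2 test_functions_dir_deriv[OF \<phi> i] has_weak_deriv_def)
  qed
qed

text \<open>Both sides of the integration by parts formula pass to a bounded pointwise limit. For a kinked
  limit this replaces integration by parts on the two sides of the kink.\<close>

lemma has_weak_deriv_limit:
  assumes S: "S \<in> sets borel" "bounded S" and i: "i \<in> Basis"
    and u: "\<And>n. smooth (u n)"
    and meas: "v \<in> borel_measurable borel" "g \<in> borel_measurable borel"
    and lim: "\<And>x. x \<in> S \<Longrightarrow> (\<lambda>n. u n x) \<longlonglongrightarrow> v x" "\<And>x. x \<in> S \<Longrightarrow> (\<lambda>n. dir_deriv i (u n) x) \<longlonglongrightarrow> g x"
    and bound: "\<And>n x. x \<in> S \<Longrightarrow> \<bar>u n x\<bar> \<le> B" "\<And>n x. x \<in> S \<Longrightarrow> \<bar>dir_deriv i (u n) x\<bar> \<le> B"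
  shows "has_weak_deriv S i v g"
  unfolding has_weak_deriv_def
proof (intro conjI ballI)
  have "\<bar>v x\<bar> \<le> B" "\<bar>g x\<bar> \<le> B" if "x \<in> S" for x
    using LIMSEQ_le_const2[OF tendsto_rabs[OF lim(1)[OF that]]] bound(1)[OF that]
      LIMSEQ_le_const2[OF tendsto_rabs[OF lim(2)[OF that]]] bound(2)[OF that] by auto
  then show "v \<in> L2 S" "g \<in> L2 S" using S meas by (auto intro: L2I_bounded)
  fix \<phi> assume \<phi>: "\<phi> \<in> test_functions S"
  have w: "set_integrable lborel S \<psi>" if "\<psi> \<in> test_functions S" for \<psi>
    using that S by (intro L2_integrable test_function_L2)
  have "(\<lambda>n. LINT x:S|lborel. u n x * dir_deriv i \<phi> x) \<longlonglongrightarrow> (LINT x:S|lborel. v x * dir_deriv i \<phi> x)"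
    using lim bound
    by (intro set_integral_bounded_convergence[where B = B] S w test_functions_dir_deriv \<phi> i meas
        smooth_measurable u) auto
  moreover have "(\<lambda>n. - (LINT x:S|lborel. dir_deriv i (u n) x * \<phi> x)) \<longlonglongrightarrow> - (LINT x:S|lborel. g x * \<phi> x)"
    using lim bound
    by (intro tendsto_minus set_integral_bounded_convergence[where B = B] S w \<phi> meas
        smooth_measurable smooth_dir_deriv u i) auto
  ultimately show "(LINT x:S|lborel. v x * dir_deriv i \<phi> x) = - (LINT x:S|lborel. g x * \<phi> x)"
    using integration_by_parts[OF u \<phi> i] by (simp add: LIMSEQ_unique)
qed

lemma has_weak_deriv_smooth:
  assumes "smooth u" "S \<in> sets borel" "bounded S" "i \<in> Basis"
  shows "has_weak_deriv S i u (dir_deriv i u)"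
  using assms by (auto simp: has_weak_deriv_def integration_by_parts smooth_L2 smooth_dir_deriv)

text \<open>Bounded pointwise convergence of the functions and of their gradients implies convergence in
  the \<open>H\<^sup>1\<close>-norm on a bounded set.\<close>

lemma H10I_limit:
  assumes S: "open S" "bounded S"
    and u: "\<And>n. u n \<in> test_functions S"
    and meas: "v \<in> borel_measurable borel" "\<And>i. i \<in> Basis \<Longrightarrow> G i \<in> borel_measurable borel"
    and lim: "\<And>x. x \<in> S \<Longrightarrow> (\<lambda>n. u n x) \<longlonglongrightarrow> v x"
      "\<And>i x. i \<in> Basis \<Longrightarrow> x \<in> S \<Longrightarrow> (\<lambda>n. dir_deriv i (u n) x) \<longlonglongrightarrow> G i x"
    and bound: "\<And>i. i \<in> Basis \<Longrightarrow> \<exists>B. \<forall>n. \<forall>x\<in>S. \<bar>u n x\<bar> \<le> B \<and> \<bar>dir_deriv i (u n) x\<bar> \<le> B"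
  shows "v \<in> H10 S"
proof -
  have borel: "S \<in> sets borel" using S by simp
  have smooth: "smooth (u n)" for n using u by (rule test_functions_smooth)
  have weak: "has_weak_deriv S i v (G i)" if i: "i \<in> Basis" for i
  proof -
    obtain B where "\<And>n x. x \<in> S \<Longrightarrow> \<bar>u n x\<bar> \<le> B \<and> \<bar>dir_deriv i (u n) x\<bar> \<le> B"
      using bound[OF i] by auto
    then show ?thesis using i
      by (intro has_weak_deriv_limit[OF borel S(2) i smooth meas(1) meas(2) lim(1) lim(2)]) auto
  qed
  have norm: "H1_norm S (\<lambda>x. v x - u n x) = sqrt ((L2_norm S (\<lambda>x. v x - u n x))\<^sup>2
      + (\<Sum>i\<in>Basis. (L2_norm S (\<lambda>x. G i x - dir_deriv i (u n) x))\<^sup>2))" for n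
    by (intro H1_norm_eq S has_weak_deriv_diff borel weak has_weak_deriv_smooth smooth)
  have tendsto: "(\<lambda>n. L2_norm S (\<lambda>x. f x - s n x)) \<longlonglongrightarrow> 0"
    if f: "f \<in> borel_measurable borel" and s: "\<And>n. s n \<in> borel_measurable borel"
      and l: "\<And>x. x \<in> S \<Longrightarrow> (\<lambda>n. s n x) \<longlonglongrightarrow> f x" and b: "\<And>n x. x \<in> S \<Longrightarrow> \<bar>s n x\<bar> \<le> B" for f s B
  proof (rule L2_norm_tendsto_0[where B = "B + B"])
    show "AE x\<in>S in lborel. (\<lambda>n. f x - s n x) \<longlonglongrightarrow> 0"
    proof (intro AE_I2 impI)
      fix x assume "x \<in> S"
      from tendsto_diff[OF tendsto_const l[OF this], of "f x"]
      show "(\<lambda>n. f x - s n x) \<longlonglongrightarrow> 0" by simp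
    qed
    fix n x assume x: "x \<in> S"
    have "\<bar>f x\<bar> \<le> B" using LIMSEQ_le_const2[OF tendsto_rabs[OF l[OF x]]] b[OF x] by auto
    then show "\<bar>f x - s n x\<bar> \<le> B + B" using b[OF x, of n] by linarith
  qed (use S f s in auto)
  have "(\<lambda>n. H1_norm S (\<lambda>x. v x - u n x)) \<longlonglongrightarrow> sqrt (0\<^sup>2 + (\<Sum>i\<in>(Basis::'a set). 0\<^sup>2))"
    unfolding norm
  proof (intro tendsto_intros)
    obtain i :: 'a where "i \<in> Basis" using nonempty_Basis by blast
    then obtain B where "\<And>n x. x \<in> S \<Longrightarrow> \<bar>u n x\<bar> \<le> B" using bound by meson
    then show "(\<lambda>n. L2_norm S (\<lambda>x. v x - u n x)) \<longlonglongrightarrow> 0"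
      using lim(1) by (intro tendsto meas smooth_measurable smooth)
  next
    fix i :: 'a assume i: "i \<in> Basis"
    then obtain B where "\<And>n x. x \<in> S \<Longrightarrow> \<bar>dir_deriv i (u n) x\<bar> \<le> B" using bound by meson
    then show "(\<lambda>n. L2_norm S (\<lambda>x. G i x - dir_deriv i (u n) x)) \<longlonglongrightarrow> 0"
      using lim(2) i by (intro tendsto meas smooth_measurable smooth_dir_deriv smooth)
  qed
  then have "(\<lambda>n. H1_norm S (\<lambda>x. v x - u n x)) \<longlonglongrightarrow> 0" by simp
  then have "\<exists>\<phi>\<in>test_functions S. H1_norm S (\<lambda>x. v x - \<phi> x) < \<epsilon>" if "\<epsilon> > 0" for \<epsilon>
    using u eventually_happens'[OF sequentially_bot order_tendstoD(2)[OF _ that]] by blast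
  moreover have "v \<in> sobolev 1 S"
    using weak weak[OF SOME_Basis] unfolding One_nat_def by (auto simp: has_weak_deriv_def)
  ultimately show ?thesis by (simp add: H10_def)
qed

lemma H10_L2: "u \<in> H10 S \<Longrightarrow> u \<in> L2 S"
  by (simp add: H10_def)

lemma zero_H10:
  assumes "open S" "bounded S"
  shows "(\<lambda>x. 0) \<in> H10 S" "H1_norm S (\<lambda>x. 0) = 0"
proof -
  have "(\<lambda>x. 0) \<in> test_functions S"
    by (rule test_functionsI[where K = "{}"]) (auto intro: smooth_const)
  then show "(\<lambda>x. 0) \<in> H10 S"
    using assms by (intro H10I_limit[where u = "\<lambda>n x. 0" and G = "\<lambda>i x. 0"]) auto
  have "has_weak_deriv S i (\<lambda>x. 0) (\<lambda>x. 0)" if "i \<in> Basis" for i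
    using has_weak_deriv_smooth[OF smooth_const[of 0] _ assms(2) that] assms(1) by simp
  from H1_norm_eq[OF assms this] show "H1_norm S (\<lambda>x. 0) = 0"
    by (simp add: L2_norm_def set_lebesgue_integral_def)
qed

section \<open>Kinks\<close>

text \<open>A smooth amplitude times the distance, up to scaling, from the hyperplane \<open>x \<bullet> p + c = 0\<close>.
  Slices of a kink in space-time at fixed time or fixed place are kinks again, which is why the
  definition is made in any Euclidean space.\<close>

definition kink :: "('a::euclidean_space \<Rightarrow> real) \<Rightarrow> 'a \<Rightarrow> real \<Rightarrow> 'a \<Rightarrow> real" where
  "kink \<eta> p c x = \<eta> x * \<bar>x \<bullet> p + c\<bar>"

text \<open>The value at the hyperplane itself is the limit of the derivatives of the smooth
  approximations \<open>soft_kink\<close>, as \<open>sgn 0 = 0\<close>.\<close>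

definition kink_deriv :: "('a::euclidean_space \<Rightarrow> real) \<Rightarrow> 'a \<Rightarrow> real \<Rightarrow> 'a \<Rightarrow> 'a \<Rightarrow> real" where
  "kink_deriv \<eta> p c i x = dir_deriv i \<eta> x * \<bar>x \<bullet> p + c\<bar> + \<eta> x * ((i \<bullet> p) * sgn (x \<bullet> p + c))"

definition soft_kink :: "nat \<Rightarrow> ('a::euclidean_space \<Rightarrow> real) \<Rightarrow> 'a \<Rightarrow> real \<Rightarrow> 'a \<Rightarrow> real" where
  "soft_kink n \<eta> p c x = \<eta> x * soft_abs n (x \<bullet> p + c)"

lemma smooth_soft_abs_affine: "smooth (\<lambda>x. soft_abs n (x \<bullet> p + c))"
  by (rule smooth_chain[OF smooth_soft_abs smooth_inner])

lemma dir_deriv_soft_abs_affine: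
  "dir_deriv i (\<lambda>x. soft_abs n (x \<bullet> p + c)) = (\<lambda>x. (i \<bullet> p) * soft_sgn n (x \<bullet> p + c))"
  by (subst dir_deriv_chain[OF smooth_differentiable[OF smooth_soft_abs]
        smooth_differentiable[OF smooth_inner]])
    (simp only: dir_deriv_soft_abs dir_deriv_inner mult.commute)

lemma smooth_soft_kink: "smooth \<eta> \<Longrightarrow> smooth (soft_kink n \<eta> p c)"
  unfolding soft_kink_def[abs_def] by (intro smooth_mult smooth_soft_abs_affine)

lemma dir_deriv_soft_kink:
  assumes "smooth \<eta>"
  shows "dir_deriv i (soft_kink n \<eta> p c)
    = (\<lambda>x. \<eta> x * ((i \<bullet> p) * soft_sgn n (x \<bullet> p + c)) + dir_deriv i \<eta> x * soft_abs n (x \<bullet> p + c))"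
  unfolding soft_kink_def[abs_def]
    dir_deriv_mult[OF smooth_differentiable[OF assms] smooth_differentiable[OF smooth_soft_abs_affine]]
    dir_deriv_soft_abs_affine ..

lemma soft_kink_tendsto: "(\<lambda>n. soft_kink n \<eta> p c x) \<longlonglongrightarrow> kink \<eta> p c x"
  unfolding soft_kink_def kink_def by (intro tendsto_intros soft_abs_tendsto)

lemma dir_deriv_soft_kink_tendsto:
  assumes "smooth \<eta>"
  shows "(\<lambda>n. dir_deriv i (soft_kink n \<eta> p c) x) \<longlonglongrightarrow> kink_deriv \<eta> p c i x"
  unfolding dir_deriv_soft_kink[OF assms] kink_deriv_def
  by (subst (2) add.commute, intro tendsto_intros soft_abs_tendsto soft_sgn_tendsto)

lemma soft_abs_affine_bounded:
  fixes S :: "'a::euclidean_space set"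
  assumes "bounded S"
  obtains B where "B \<ge> 0" "\<And>n x. x \<in> S \<Longrightarrow> \<bar>soft_abs n (x \<bullet> p + c)\<bar> \<le> B"
proof -
  obtain B where B: "B \<ge> 0" "\<And>x. x \<in> S \<Longrightarrow> \<bar>x \<bullet> p + c\<bar> \<le> B"
    using continuous_bounded_on[OF smooth_continuous[OF smooth_inner] assms] by metis
  have "\<bar>soft_abs n (x \<bullet> p + c)\<bar> \<le> B + 1" if "x \<in> S" for n x
    using soft_abs_bound[of n "x \<bullet> p + c"] soft_abs_pos[of n "x \<bullet> p + c"] B(2)[OF that] by linarith
  then show thesis using B(1) by (intro that[of "B + 1"]) auto
qed

lemma soft_kink_bounded:
  assumes "smooth \<eta>" "bounded S" "i \<in> Basis"
  shows "\<exists>B. \<forall>n. \<forall>x\<in>S. \<bar>soft_kink n \<eta> p c x\<bar> \<le> B \<and> \<bar>dir_deriv i (soft_kink n \<eta> p c) x\<bar> \<le> B"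
proof -
  obtain A where A: "A \<ge> 0" "\<And>n x. x \<in> S \<Longrightarrow> \<bar>soft_abs n (x \<bullet> p + c)\<bar> \<le> A"
    using soft_abs_affine_bounded[OF assms(2)] by metis
  obtain C where C: "C \<ge> 0" "\<And>x. x \<in> S \<Longrightarrow> \<bar>\<eta> x\<bar> \<le> C"
    using continuous_bounded_on[OF smooth_continuous[OF assms(1)] assms(2)] by metis
  obtain D where D: "D \<ge> 0" "\<And>x. x \<in> S \<Longrightarrow> \<bar>dir_deriv i \<eta> x\<bar> \<le> D"
    using continuous_bounded_on[OF smooth_continuous[OF smooth_dir_deriv[OF assms(1,3)]] assms(2)] by metis
  have "\<bar>soft_kink n \<eta> p c x\<bar> \<le> C * A" if "x \<in> S" for n x
    unfolding soft_kink_def abs_mult using A C that by (intro mult_mono) auto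
  moreover have "\<bar>dir_deriv i (soft_kink n \<eta> p c) x\<bar> \<le> C * (\<bar>i \<bullet> p\<bar> * 1) + D * A" if "x \<in> S" for n x
  proof -
    have "\<bar>\<eta> x * ((i \<bullet> p) * soft_sgn n (x \<bullet> p + c))\<bar> \<le> C * (\<bar>i \<bullet> p\<bar> * 1)"
      unfolding abs_mult using C that soft_sgn_bound by (intro mult_mono mult_left_mono) auto
    moreover have "\<bar>dir_deriv i \<eta> x * soft_abs n (x \<bullet> p + c)\<bar> \<le> D * A"
      unfolding abs_mult using A D that by (intro mult_mono) auto
    ultimately show ?thesis unfolding dir_deriv_soft_kink[OF assms(1)] by linarith
  qed
  moreover have "0 \<le> C * A" "0 \<le> C * (\<bar>i \<bullet> p\<bar> * 1) + D * A" using A C D by auto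
  ultimately have "\<bar>soft_kink n \<eta> p c x\<bar> \<le> C * A + (C * (\<bar>i \<bullet> p\<bar> * 1) + D * A) \<and>
      \<bar>dir_deriv i (soft_kink n \<eta> p c) x\<bar> \<le> C * A + (C * (\<bar>i \<bullet> p\<bar> * 1) + D * A)" if "x \<in> S" for n x
    using that by (meson add_increasing add_increasing2)
  then show ?thesis by blast
qed

lemma kink_measurable:
  assumes "smooth \<eta>"
  shows "kink \<eta> p c \<in> borel_measurable borel"
proof -
  have [measurable]: "\<eta> \<in> borel_measurable borel" using assms by (rule smooth_measurable)
  show ?thesis unfolding kink_def[abs_def] by measurable
qed

lemma kink_deriv_measurable:
  assumes "smooth \<eta>" "i \<in> Basis"
  shows "kink_deriv \<eta> p c i \<in> borel_measurable borel"
proof -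
  have [measurable]: "\<eta> \<in> borel_measurable borel" "dir_deriv i \<eta> \<in> borel_measurable borel"
    using assms by (auto simp: smooth_measurable smooth_dir_deriv)
  show ?thesis unfolding kink_deriv_def[abs_def] by measurable
qed

lemma kink_has_weak_deriv:
  assumes "smooth \<eta>" "S \<in> sets borel" "bounded S" "i \<in> Basis"
  shows "has_weak_deriv S i (kink \<eta> p c) (kink_deriv \<eta> p c i)"
proof -
  obtain B where "\<And>n x. x \<in> S \<Longrightarrow> \<bar>soft_kink n \<eta> p c x\<bar> \<le> B \<and> \<bar>dir_deriv i (soft_kink n \<eta> p c) x\<bar> \<le> B"
    using soft_kink_bounded[OF assms(1,3,4)] by meson
  then show ?thesis
    using assms
    by (intro has_weak_deriv_limit[where u = "\<lambda>n. soft_kink n \<eta> p c" and B = B] smooth_soft_kink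
        kink_measurable kink_deriv_measurable soft_kink_tendsto dir_deriv_soft_kink_tendsto) auto
qed

lemma kink_H10:
  assumes "\<eta> \<in> test_functions S" "open S" "bounded S"
  shows "kink \<eta> p c \<in> H10 S"
proof -
  have \<eta>: "smooth \<eta>" using assms(1) by (rule test_functions_smooth)
  show ?thesis
  proof (rule H10I_limit[where u = "\<lambda>n. soft_kink n \<eta> p c" and G = "\<lambda>i. kink_deriv \<eta> p c i"])
    show "soft_kink n \<eta> p c \<in> test_functions S" for n
      unfolding soft_kink_def[abs_def] by (intro test_functions_mult assms smooth_soft_abs_affine)
  qed (use assms \<eta> in \<open>auto intro: soft_kink_tendsto dir_deriv_soft_kink_tendsto
      kink_measurable kink_deriv_measurable soft_kink_bounded\<close>)
qed

section \<open>The space-time cylinder\<close>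

lemma open_cylinder: "open \<Omega> \<Longrightarrow> open (cylinder \<Omega> T)"
  by (simp add: cylinder_def open_Times)

lemma bounded_cylinder: "bounded \<Omega> \<Longrightarrow> bounded (cylinder \<Omega> T)"
  by (simp add: cylinder_def bounded_Times)

lemma Basis_prod_intros:
  "i \<in> Basis \<Longrightarrow> (i, 0) \<in> Basis" "(0 :: 'a::euclidean_space, 1 :: real) \<in> Basis"
  by (auto simp: Basis_prod_def)

lemma cylinder_borel: "open \<Omega> \<Longrightarrow> cylinder \<Omega> T \<in> sets borel"
  by (simp add: open_cylinder)

lemma test_functions_outside: "\<phi> \<in> test_functions S \<Longrightarrow> x \<notin> S \<Longrightarrow> \<phi> x = 0"
  by (auto elim!: test_functionsE)

lemma has_time_derivD:
  assumes "has_time_deriv \<Omega> T v g" "\<phi> \<in> test_functions {0<..<T}"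
  shows "AE x\<in>\<Omega> in lborel. (LINT t:{0<..<T}|lborel. deriv \<phi> t * v (x, t))
    = - (LINT t:{0<..<T}|lborel. \<phi> t * g (x, t))"
  using assms unfolding has_time_deriv_def by blast

lemma has_time_derivI:
  assumes L2: "v \<in> L2 (cylinder \<Omega> T)" "g \<in> L2 (cylinder \<Omega> T)"
    and slices: "\<And>x. x \<in> \<Omega> \<Longrightarrow> has_weak_deriv {0<..<T} 1 (\<lambda>t. v (x, t)) (\<lambda>t. g (x, t))"
  shows "has_time_deriv \<Omega> T v g"
  unfolding has_time_deriv_def
proof (intro conjI ballI L2 AE_I2 impI)
  fix \<phi> x assume \<phi>: "\<phi> \<in> test_functions {0<..<T}" and "x \<in> \<Omega>"
  then show "(LINT t:{0<..<T}|lborel. deriv \<phi> t * v (x, t)) = - (LINT t:{0<..<T}|lborel. \<phi> t * g (x, t))"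
    using slices[of x] deriv_eq_dir_deriv[OF test_functions_smooth[OF \<phi>]]
    by (simp add: has_weak_deriv_def mult.commute)
qed

lemma slice_measurable:
  fixes f :: "'a::euclidean_space \<times> real \<Rightarrow> real"
  assumes "f \<in> borel_measurable borel"
  shows "(\<lambda>x. f (x, t)) \<in> borel_measurable borel"
  by (rule measurable_compose[OF _ assms]) (intro borel_measurable_continuous_onI continuous_intros)

text \<open>Continuity in time with values in \<open>L\<^sup>2(\<Omega>)\<close> only needs continuity at \<open>t\<close> for almost every \<open>x\<close>. The
  time derivative of a kink jumps, but at each time it does so on a hyperplane in space only.\<close>

lemma L2_norm_slices_tendsto:
  fixes f :: "'a::euclidean_space \<times> real \<Rightarrow> real"
  assumes \<Omega>: "\<Omega> \<in> sets borel" "bounded \<Omega>" and f: "f \<in> borel_measurable borel"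
    and bound: "\<And>x t. x \<in> \<Omega> \<Longrightarrow> t \<in> I \<Longrightarrow> \<bar>f (x, t)\<bar> \<le> B"
    and t: "t \<in> I" and cont: "AE x\<in>\<Omega> in lborel. isCont (\<lambda>s. f (x, s)) t"
  shows "((\<lambda>s. L2_norm \<Omega> (\<lambda>x. f (x, s) - f (x, t))) \<longlongrightarrow> 0) (at t within I)"
  unfolding tendsto_at_iff_sequentially comp_def
proof (intro allI impI)
  fix X assume X: "\<forall>n. X n \<in> I - {t}" "X \<longlonglongrightarrow> t"
  show "(\<lambda>n. L2_norm \<Omega> (\<lambda>x. f (x, X n) - f (x, t))) \<longlonglongrightarrow> 0"
  proof (rule L2_norm_tendsto_0[OF \<Omega>, where B = "B + B"])
    show "AE x\<in>\<Omega> in lborel. (\<lambda>n. f (x, X n) - f (x, t)) \<longlonglongrightarrow> 0"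
      using cont
    proof eventually_elim
      fix x assume *: "x \<in> \<Omega> \<longrightarrow> isCont (\<lambda>s. f (x, s)) t"
      show "x \<in> \<Omega> \<longrightarrow> (\<lambda>n. f (x, X n) - f (x, t)) \<longlonglongrightarrow> 0"
        using * isCont_tendsto_compose[of t "\<lambda>s. f (x, s)" X] X(2) by (auto intro: LIM_zero)
    qed
    show "\<bar>f (x, X n) - f (x, t)\<bar> \<le> B + B" if "x \<in> \<Omega>" for n x
      using bound[OF that t] bound[OF that, of "X n"] X(1) by auto
  qed (use f in \<open>auto intro!: borel_measurable_diff slice_measurable\<close>)
qed

lemma AE_not_on_hyperplane:
  fixes a :: "'a::euclidean_space"
  assumes "a \<noteq> 0"
  shows "AE x in lborel. x \<bullet> a + d \<noteq> 0"
proof -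
  let ?N = "{x. a \<bullet> x = - d}"
  have "?N \<in> null_sets lebesgue"
    using negligible_hyperplane[of a "- d"] assms by (simp add: negligible_iff_null_sets)
  moreover have "?N \<in> sets lborel" by (simp add: closed_hyperplane)
  ultimately have "?N \<in> null_sets lborel" by (simp add: null_sets_completion_iff)
  then show ?thesis by (rule AE_I') (auto simp: inner_commute)
qed

section \<open>Square integrable functions as functionals\<close>

lemma L2_functional_dual:
  assumes g: "g \<in> L2 S"
  shows "(\<lambda>u. LINT x:S|lborel. g x * u x) \<in> H10_dual S"
  unfolding H10_dual_def
proof (intro CollectI conjI ballI allI exI[of _ "L2_norm S g"])
  fix u v a b assume uv: "u \<in> H10 S" "v \<in> H10 S"
  have "set_integrable lborel S (\<lambda>x. g x * u x)" "set_integrable lborel S (\<lambda>x. g x * v x)"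
    using uv by (auto intro: L2_mult_integrable g H10_L2)
  then have "(LINT x:S|lborel. a * (g x * u x) + b * (g x * v x))
      = a * (LINT x:S|lborel. g x * u x) + b * (LINT x:S|lborel. g x * v x)"
    by (subst set_integral_add) auto
  then show "(LINT x:S|lborel. g x * (a * u x + b * v x))
      = a * (LINT x:S|lborel. g x * u x) + b * (LINT x:S|lborel. g x * v x)"
    by (simp add: algebra_simps)
next
  fix u assume u: "u \<in> H10 S"
  show "\<bar>LINT x:S|lborel. g x * u x\<bar> \<le> L2_norm S g * H1_norm S u"
    using L2_Cauchy_Schwarz[OF g H10_L2[OF u]] 
      mult_left_mono[OF L2_norm_le_H1_norm[of S u] L2_norm_nonneg[of S g]] by linarith
qed

text \<open>The embedding of \<open>L\<^sup>2\<close> into the dual of \<open>H\<^sup>1\<^sub>0\<close> is bounded, so that \<open>L\<^sup>2\<close>-continuity in time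
  yields continuity in the dual norm. The lower bound is not automatic: it uses that the
  supremum in the dual norm is taken over a nonempty bounded set of reals.\<close>

lemma L2_functional_dual_norm:
  assumes S: "open S" "bounded S" and g: "g \<in> L2 S"
    and l: "\<And>u. u \<in> H10 S \<Longrightarrow> l u = (LINT x:S|lborel. g x * u x)"
  shows "0 \<le> H10_dual_norm S l" "H10_dual_norm S l \<le> L2_norm S g"
proof -
  have bound: "\<bar>l u\<bar> \<le> L2_norm S g" if "u \<in> H10 S" "H1_norm S u \<le> 1" for u
    using L2_Cauchy_Schwarz[OF g H10_L2[OF that(1)]] l[OF that(1)] that(2) L2_norm_le_H1_norm[of S u]
      mult_left_mono[of "L2_norm S u" 1 "L2_norm S g"] L2_norm_nonneg[of S g] by auto
  have zero: "(\<lambda>x. 0) \<in> {u \<in> H10 S. H1_norm S u \<le> 1}"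
    using zero_H10[OF S] by simp
  show "H10_dual_norm S l \<le> L2_norm S g"
    unfolding H10_dual_norm_def using zero bound by (intro cSUP_least) auto
  have "bdd_above ((\<lambda>u. \<bar>l u\<bar>) ` {u \<in> H10 S. H1_norm S u \<le> 1})"
    using bound by (intro bdd_aboveI2[where M = "L2_norm S g"]) auto
  then show "0 \<le> H10_dual_norm S l"
    unfolding H10_dual_norm_def by (rule cSUP_upper2[OF _ zero]) simp
qed

section \<open>The wave operator on kinks\<close>

definition wave_op :: "('a::euclidean_space \<times> real \<Rightarrow> real) \<Rightarrow> 'a \<times> real \<Rightarrow> real" where
  "wave_op u z = dir_deriv (0, 1) (dir_deriv (0, 1) u) z
    - (\<Sum>i\<in>Basis. dir_deriv (i, 0) (dir_deriv (i, 0) u) z)"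

lemma smooth_wave_op:
  fixes u :: "'a::euclidean_space \<times> real \<Rightarrow> real"
  assumes "smooth u"
  shows "smooth (wave_op u)"
  unfolding wave_op_def[abs_def]
  by (intro smooth_diff smooth_sum finite_Basis smooth_dir_deriv Basis_prod_intros assms)

lemma set_integral_sum:
  fixes f :: "'b \<Rightarrow> 'a::euclidean_space \<Rightarrow> real"
  assumes "\<And>j. j \<in> J \<Longrightarrow> set_integrable lborel S (f j)"
  shows "(LINT x:S|lborel. \<Sum>j\<in>J. f j x) = (\<Sum>j\<in>J. LINT x:S|lborel. f j x)"
  using assms unfolding set_lebesgue_integral_def set_integrable_def scaleR_sum_right
  by (rule Bochner_Integration.integral_sum)

text \<open>The classical wave operator of a smooth function is its distributional one.\<close>

lemma wave_op_by_parts: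
  fixes u :: "'a::euclidean_space \<times> real \<Rightarrow> real"
  assumes u: "smooth u" and \<phi>: "\<phi> \<in> test_functions S" and S: "S \<in> sets borel" "bounded S"
  shows "(LINT z:S|lborel. u z * dir_deriv (0, 1) (dir_deriv (0, 1) \<phi>) z)
    - (LINT z:S|lborel. u z * (\<Sum>i\<in>Basis. dir_deriv (i, 0) (dir_deriv (i, 0) \<phi>) z))
    = (LINT z:S|lborel. wave_op u z * \<phi> z)"
proof -
  note \<phi>' = test_functions_dir_deriv[OF \<phi>]
  have twice: "(LINT z:S|lborel. u z * dir_deriv j (dir_deriv j \<phi>) z)
      = (LINT z:S|lborel. dir_deriv j (dir_deriv j u) z * \<phi> z)" if j: "j \<in> Basis" for j
    using integration_by_parts[OF u \<phi>'[OF j] j] integration_by_parts[OF smooth_dir_deriv[OF u j] \<phi> j]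
    by simp
  have int: "set_integrable lborel S (\<lambda>z. f z * \<psi> z)" if "smooth f" "\<psi> \<in> test_functions S" for f \<psi>
    using that S by (intro L2_mult_integrable smooth_L2 test_function_L2)
  have "(LINT z:S|lborel. u z * (\<Sum>i\<in>Basis. dir_deriv (i, 0) (dir_deriv (i, 0) \<phi>) z))
      = (\<Sum>i\<in>Basis. LINT z:S|lborel. u z * dir_deriv (i, 0) (dir_deriv (i, 0) \<phi>) z)"
    unfolding sum_distrib_left
    by (intro set_integral_sum int u test_functions_dir_deriv \<phi> Basis_prod_intros)
  also have "\<dots> = (\<Sum>i\<in>Basis. LINT z:S|lborel. dir_deriv (i, 0) (dir_deriv (i, 0) u) z * \<phi> z)"
    by (intro sum.cong refl twice Basis_prod_intros)
  also have "\<dots> = (LINT z:S|lborel. (\<Sum>i\<in>Basis. dir_deriv (i, 0) (dir_deriv (i, 0) u) z) * \<phi> z)"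
    unfolding sum_distrib_right
    by (intro set_integral_sum[symmetric] int u smooth_dir_deriv \<phi> Basis_prod_intros)
  finally show ?thesis
    unfolding wave_op_def left_diff_distrib twice[OF Basis_prod_intros(2)]
    by (subst set_integral_diff)
      (auto intro!: int smooth_sum smooth_dir_deriv Basis_prod_intros u \<phi>)
qed

lemma smooth_soft_sgn: "smooth (soft_sgn n)"
  using smooth_dir_deriv[OF smooth_soft_abs, of 1] by (simp add: dir_deriv_soft_abs)

lemma smooth_soft_sgn_affine: "smooth (\<lambda>x. soft_sgn n (x \<bullet> p + c))"
  by (rule smooth_chain[OF smooth_soft_sgn smooth_inner])

lemma dir_deriv_soft_sgn_affine:
  "dir_deriv i (\<lambda>x. soft_sgn n (x \<bullet> p + c))
    = (\<lambda>x. dir_deriv 1 (soft_sgn n) (x \<bullet> p + c) * (i \<bullet> p))"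
  by (subst dir_deriv_chain[OF smooth_differentiable[OF smooth_soft_sgn]
        smooth_differentiable[OF smooth_inner]])
    (simp only: dir_deriv_inner)

lemma dir_deriv2_soft_kink:
  assumes \<eta>: "smooth \<eta>" and i: "i \<in> Basis"
  shows "dir_deriv i (dir_deriv i (soft_kink n \<eta> p c)) x
    = dir_deriv i (dir_deriv i \<eta>) x * soft_abs n (x \<bullet> p + c)
      + 2 * ((i \<bullet> p) * dir_deriv i \<eta> x) * soft_sgn n (x \<bullet> p + c)
      + (i \<bullet> p)\<^sup>2 * (\<eta> x * dir_deriv 1 (soft_sgn n) (x \<bullet> p + c))"
proof -
  note d = smooth_differentiable
  have 1: "smooth (\<lambda>x. (i \<bullet> p) * soft_sgn n (x \<bullet> p + c))"
    by (intro smooth_mult smooth_const smooth_soft_sgn_affine)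
  have 2: "dir_deriv i (\<lambda>x. (i \<bullet> p) * soft_sgn n (x \<bullet> p + c))
      = (\<lambda>x. (i \<bullet> p) * (dir_deriv 1 (soft_sgn n) (x \<bullet> p + c) * (i \<bullet> p)))"
    by (subst dir_deriv_mult[OF d[OF smooth_const] d[OF smooth_soft_sgn_affine]])
      (simp add: dir_deriv_soft_sgn_affine)
  show ?thesis
    unfolding dir_deriv_soft_kink[OF \<eta>]
      dir_deriv_add[OF d[OF smooth_mult[OF \<eta> 1]]
        d[OF smooth_mult[OF smooth_dir_deriv[OF \<eta> i] smooth_soft_abs_affine]]]
      dir_deriv_mult[OF d[OF \<eta>] d[OF 1]]
      dir_deriv_mult[OF d[OF smooth_dir_deriv[OF \<eta> i]] d[OF smooth_soft_abs_affine]]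
      dir_deriv_soft_abs_affine 2
    by (simp add: algebra_simps power2_eq_square)
qed

text \<open>Twice the Lorentz product of the gradient of \<open>\<eta>\<close> with the normal \<open>(a, b)\<close> of the kink: the
  coefficient of the first derivative of \<open>\<bar>s\<bar>\<close> in the wave operator of \<open>\<eta> \<bar>s\<bar>\<close>.\<close>

definition kink_transport :: "('a::euclidean_space \<times> real \<Rightarrow> real) \<Rightarrow> 'a \<Rightarrow> real \<Rightarrow> 'a \<times> real \<Rightarrow> real" where
  "kink_transport \<eta> a b z = 2 * (b * dir_deriv (0, 1) \<eta> z - (\<Sum>i\<in>Basis. (i \<bullet> a) * dir_deriv (i, 0) \<eta> z))"

lemma smooth_kink_transport:
  fixes \<eta> :: "'a::euclidean_space \<times> real \<Rightarrow> real"
  assumes "smooth \<eta>"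
  shows "smooth (kink_transport \<eta> a b)"
  unfolding kink_transport_def[abs_def]
  by (intro smooth_mult smooth_const smooth_diff smooth_sum finite_Basis smooth_dir_deriv
      Basis_prod_intros assms)

text \<open>The second derivative of \<open>soft_abs\<close>, which is unbounded as \<open>n\<close> grows, enters with the factor
  \<open>b\<^sup>2 - \<bar>a\<bar>\<^sup>2\<close> and is removed by the null condition.\<close>

lemma wave_op_soft_kink:
  fixes \<eta> :: "'a::euclidean_space \<times> real \<Rightarrow> real"
  assumes \<eta>: "smooth \<eta>" and null: "b\<^sup>2 = a \<bullet> a"
  shows "wave_op (soft_kink n \<eta> (a, b) c) z
    = wave_op \<eta> z * soft_abs n (z \<bullet> (a, b) + c) + kink_transport \<eta> a b z * soft_sgn n (z \<bullet> (a, b) + c)"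
proof -
  define A where "A = soft_abs n (z \<bullet> (a, b) + c)"
  define A' where "A' = soft_sgn n (z \<bullet> (a, b) + c)"
  define X where "X = \<eta> z * dir_deriv 1 (soft_sgn n) (z \<bullet> (a, b) + c)"
  have t: "dir_deriv (0, 1) (dir_deriv (0, 1) (soft_kink n \<eta> (a, b) c)) z
      = dir_deriv (0, 1) (dir_deriv (0, 1) \<eta>) z * A + 2 * (b * dir_deriv (0, 1) \<eta> z) * A' + b\<^sup>2 * X"
    using dir_deriv2_soft_kink[OF \<eta> Basis_prod_intros(2), of n "(a, b)" c z]
    by (simp add: A_def A'_def X_def)
  have "(\<Sum>i\<in>Basis. dir_deriv (i, 0) (dir_deriv (i, 0) (soft_kink n \<eta> (a, b) c)) z)
      = (\<Sum>i\<in>Basis. dir_deriv (i, 0) (dir_deriv (i, 0) \<eta>) z * A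
          + 2 * ((i \<bullet> a) * dir_deriv (i, 0) \<eta> z) * A' + (i \<bullet> a)\<^sup>2 * X)"
    using dir_deriv2_soft_kink[OF \<eta> Basis_prod_intros(1), of _ n "(a, b)" c z]
    by (intro sum.cong refl) (simp add: A_def A'_def X_def)
  also have "\<dots> = (\<Sum>i\<in>Basis. dir_deriv (i, 0) (dir_deriv (i, 0) \<eta>) z) * A
      + 2 * (\<Sum>i\<in>Basis. (i \<bullet> a) * dir_deriv (i, 0) \<eta> z) * A' + (\<Sum>i\<in>Basis. (i \<bullet> a)\<^sup>2) * X"
    by (simp only: sum.distrib sum_distrib_right sum_distrib_left)
  also have "(\<Sum>i\<in>Basis. (i \<bullet> a)\<^sup>2) = b\<^sup>2"
    unfolding null euclidean_inner[of a a] by (simp add: power2_eq_square inner_commute)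
  finally show ?thesis
    unfolding wave_op_def[of "soft_kink n \<eta> (a, b) c"] t
    unfolding wave_op_def kink_transport_def A_def[symmetric] A'_def[symmetric]
    by (simp add: algebra_simps)
qed

lemma kink_has_wave:
  fixes \<eta> :: "'a::euclidean_space \<times> real \<Rightarrow> real"
  assumes \<eta>: "smooth \<eta>" and \<Omega>: "open \<Omega>" "bounded \<Omega>" and null: "b\<^sup>2 = a \<bullet> a"
  shows "has_wave \<Omega> T (kink \<eta> (a, b) c)
    (\<lambda>z. wave_op \<eta> z * \<bar>z \<bullet> (a, b) + c\<bar> + kink_transport \<eta> a b z * sgn (z \<bullet> (a, b) + c))"
    (is "has_wave \<Omega> T ?v ?g")
proof -
  define S where "S = cylinder \<Omega> T"
  have S: "open S" "S \<in> sets borel" "bounded S"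
    using \<Omega> by (auto simp: S_def open_cylinder cylinder_borel bounded_cylinder)
  define v where "v n = soft_kink n \<eta> (a, b) c" for n
  have v: "smooth (v n)" for n unfolding v_def by (rule smooth_soft_kink[OF \<eta>])
  have v_L2: "?v \<in> L2 S"
    using kink_has_weak_deriv[OF \<eta> S(2,3) Basis_prod_intros(2)] by (simp add: has_weak_deriv_def)
  have v_lim: "(\<lambda>n. v n z) \<longlonglongrightarrow> ?v z" for z unfolding v_def by (rule soft_kink_tendsto)
  obtain B where B: "\<And>n z. z \<in> S \<Longrightarrow> \<bar>v n z\<bar> \<le> B"
    unfolding v_def using soft_kink_bounded[OF \<eta> S(3) Basis_prod_intros(2)] by meson
  have wave: "wave_op (v n) z = wave_op \<eta> z * soft_abs n (z \<bullet> (a, b) + c)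
      + kink_transport \<eta> a b z * soft_sgn n (z \<bullet> (a, b) + c)" for n z
    unfolding v_def by (rule wave_op_soft_kink[OF \<eta> null])
  have g_lim: "(\<lambda>n. wave_op (v n) z) \<longlonglongrightarrow> ?g z" for z
    unfolding wave by (intro tendsto_intros soft_abs_tendsto soft_sgn_tendsto)
  obtain C where C: "\<And>n z. z \<in> S \<Longrightarrow> \<bar>wave_op (v n) z\<bar> \<le> C"
  proof -
    obtain A where A: "A \<ge> 0" "\<And>n z. z \<in> S \<Longrightarrow> \<bar>soft_abs n (z \<bullet> (a, b) + c)\<bar> \<le> A"
      using soft_abs_affine_bounded[OF S(3), of "(a, b)" c] by metis
    obtain D where D: "D \<ge> 0" "\<And>z. z \<in> S \<Longrightarrow> \<bar>wave_op \<eta> z\<bar> \<le> D"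
      using continuous_bounded_on[OF smooth_continuous[OF smooth_wave_op[OF \<eta>]] S(3)] by metis
    obtain E where E: "E \<ge> 0" "\<And>z. z \<in> S \<Longrightarrow> \<bar>kink_transport \<eta> a b z\<bar> \<le> E"
      using continuous_bounded_on[OF smooth_continuous[OF smooth_kink_transport[OF \<eta>]] S(3)] by metis
    show thesis
    proof (rule that[of "D * A + E * 1"])
      fix n z assume z: "z \<in> S"
      have "\<bar>wave_op \<eta> z * soft_abs n (z \<bullet> (a, b) + c)\<bar> \<le> D * A"
        unfolding abs_mult using z A D by (intro mult_mono) auto
      moreover have "\<bar>kink_transport \<eta> a b z * soft_sgn n (z \<bullet> (a, b) + c)\<bar> \<le> E * 1"
        unfolding abs_mult using z E soft_sgn_bound by (intro mult_mono) auto
      ultimately show "\<bar>wave_op (v n) z\<bar> \<le> D * A + E * 1" unfolding wave by linarith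
    qed
  qed
  have g_meas: "?g \<in> borel_measurable borel"
  proof (rule borel_measurable_LIMSEQ_real[OF g_lim])
    show "wave_op (v n) \<in> borel_measurable borel" for n by (intro smooth_measurable smooth_wave_op v)
  qed
  have "\<bar>?g z\<bar> \<le> C" if "z \<in> S" for z
    using LIMSEQ_le_const2[OF tendsto_rabs[OF g_lim[of z]]] C[OF that] by auto
  then have g_L2: "?g \<in> L2 S" by (intro L2I_bounded[OF S(2,3) g_meas])
  show ?thesis
    unfolding has_wave_def S_def[symmetric]
  proof (intro conjI v_L2 g_L2 ballI)
    fix \<phi> assume \<phi>: "\<phi> \<in> test_functions S"
    have w: "set_integrable lborel S \<psi>" if "smooth \<psi>" for \<psi>
      using that S by (intro L2_integrable smooth_L2)
    note \<phi>s = test_functions_smooth[OF \<phi>]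
    have v_conv: "(\<lambda>n. LINT z:S|lborel. v n z * \<psi> z) \<longlonglongrightarrow> (LINT z:S|lborel. ?v z * \<psi> z)"
      if "smooth \<psi>" for \<psi>
      using v_lim B that
      by (intro set_integral_bounded_convergence[where B = B] S w smooth_measurable v
          kink_measurable \<eta>) auto
    have "(\<lambda>n. (LINT z:S|lborel. v n z * dir_deriv (0, 1) (dir_deriv (0, 1) \<phi>) z)
        - (LINT z:S|lborel. v n z * (\<Sum>i\<in>Basis. dir_deriv (i, 0) (dir_deriv (i, 0) \<phi>) z)))
      \<longlonglongrightarrow> (LINT z:S|lborel. ?v z * dir_deriv (0, 1) (dir_deriv (0, 1) \<phi>) z)
        - (LINT z:S|lborel. ?v z * (\<Sum>i\<in>Basis. dir_deriv (i, 0) (dir_deriv (i, 0) \<phi>) z))"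
      by (intro tendsto_diff v_conv smooth_sum finite_Basis smooth_dir_deriv \<phi>s Basis_prod_intros)
    moreover have "(\<lambda>n. LINT z:S|lborel. wave_op (v n) z * \<phi> z) \<longlonglongrightarrow> (LINT z:S|lborel. ?g z * \<phi> z)"
      using g_lim C
      by (intro set_integral_bounded_convergence[where B = C] S w smooth_measurable smooth_wave_op v
          \<phi>s g_meas) auto
    ultimately show "(LINT z:S|lborel. ?v z * dir_deriv (0, 1) (dir_deriv (0, 1) \<phi>) z)
        - (LINT z:S|lborel. ?v z * (\<Sum>i\<in>Basis. dir_deriv (i, 0) (dir_deriv (i, 0) \<phi>) z))
      = (LINT z:S|lborel. ?g z * \<phi> z)"
      unfolding wave_op_by_parts[OF v \<phi> S(2,3)] by (rule LIMSEQ_unique)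
  qed
qed

section \<open>Kinks in space-time\<close>

lemma kink_slice_fst: "(\<lambda>x. kink \<eta> (a, b) c (x, t)) = kink (\<lambda>x. \<eta> (x, t)) a (t * b + c)"
  and kink_slice_snd: "(\<lambda>t. kink \<eta> (a, b) c (x, t)) = kink (\<lambda>t. \<eta> (x, t)) b (x \<bullet> a + c)"
  by (auto simp: kink_def algebra_simps)

lemma kink_deriv_slice_fst:
  "smooth \<eta> \<Longrightarrow> (\<lambda>x. kink_deriv \<eta> (a, b) c (i, 0) (x, t)) = kink_deriv (\<lambda>x. \<eta> (x, t)) a (t * b + c) i"
  and kink_deriv_slice_snd:
  "smooth \<eta> \<Longrightarrow> (\<lambda>t. kink_deriv \<eta> (a, b) c (0, 1) (x, t)) = kink_deriv (\<lambda>t. \<eta> (x, t)) b (x \<bullet> a + c) 1"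
  by (auto simp: kink_deriv_def dir_deriv_slice_fst dir_deriv_slice_snd algebra_simps)

lemma kink_bounded:
  assumes "smooth \<eta>" "bounded S" "i \<in> Basis"
  shows "\<exists>B. \<forall>x\<in>S. \<bar>kink \<eta> p c x\<bar> \<le> B \<and> \<bar>kink_deriv \<eta> p c i x\<bar> \<le> B"
proof -
  obtain B where B: "\<And>n x. x \<in> S \<Longrightarrow> \<bar>soft_kink n \<eta> p c x\<bar> \<le> B \<and> \<bar>dir_deriv i (soft_kink n \<eta> p c) x\<bar> \<le> B"
    using soft_kink_bounded[OF assms] by meson
  have "\<bar>kink \<eta> p c x\<bar> \<le> B" "\<bar>kink_deriv \<eta> p c i x\<bar> \<le> B" if "x \<in> S" for x
    using LIMSEQ_le_const2[OF tendsto_rabs[OF soft_kink_tendsto]] B[OF that]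
      LIMSEQ_le_const2[OF tendsto_rabs[OF dir_deriv_soft_kink_tendsto[OF assms(1)]]] by blast+
  then show ?thesis by blast
qed

lemma kink_has_time_deriv:
  fixes \<eta> :: "'a::euclidean_space \<times> real \<Rightarrow> real"
  assumes \<eta>: "smooth \<eta>" and \<Omega>: "open \<Omega>" "bounded \<Omega>"
  shows "has_time_deriv \<Omega> T (kink \<eta> (a, b) c) (kink_deriv \<eta> (a, b) c (0, 1))"
proof (rule has_time_derivI)
  show "kink \<eta> (a, b) c \<in> L2 (cylinder \<Omega> T)" "kink_deriv \<eta> (a, b) c (0, 1) \<in> L2 (cylinder \<Omega> T)"
    using kink_has_weak_deriv[OF \<eta> _ bounded_cylinder[OF \<Omega>(2)] Basis_prod_intros(2)] open_cylinder[OF \<Omega>(1)]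
    by (auto simp: has_weak_deriv_def)
  show "has_weak_deriv {0<..<T} 1 (\<lambda>t. kink \<eta> (a, b) c (x, t)) (\<lambda>t. kink_deriv \<eta> (a, b) c (0, 1) (x, t))" for x
    unfolding kink_slice_snd kink_deriv_slice_snd[OF \<eta>]
    by (intro kink_has_weak_deriv smooth_slice_snd \<eta>) auto
qed

lemma kink_L2_time_H10:
  fixes \<eta> :: "'a::euclidean_space \<times> real \<Rightarrow> real"
  assumes \<eta>: "\<eta> \<in> test_functions (cylinder \<Omega> T)" and \<Omega>: "open \<Omega>" "bounded \<Omega>"
  shows "kink \<eta> (a, b) c \<in> L2_time_H10 \<Omega> T"
proof -
  have \<eta>s: "smooth \<eta>" using \<eta> by (rule test_functions_smooth)
  have cyl: "cylinder \<Omega> T \<in> sets borel" "bounded (cylinder \<Omega> T)"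
    using open_cylinder[OF \<Omega>(1)] bounded_cylinder[OF \<Omega>(2)] by auto
  have L2: "kink \<eta> (a, b) c \<in> L2 (cylinder \<Omega> T)" "kink_deriv \<eta> (a, b) c (i, 0) \<in> L2 (cylinder \<Omega> T)"
    if "i \<in> Basis" for i
    using kink_has_weak_deriv[OF \<eta>s cyl Basis_prod_intros(1)[OF that]] by (auto simp: has_weak_deriv_def)
  have "(\<lambda>x. kink \<eta> (a, b) c (x, t)) \<in> H10 \<Omega>" for t
    unfolding kink_slice_fst using \<eta> unfolding cylinder_def
    by (intro kink_H10 \<Omega> test_functions_slice_fst)
  moreover have "has_weak_deriv \<Omega> i (\<lambda>x. kink \<eta> (a, b) c (x, t)) (\<lambda>x. kink_deriv \<eta> (a, b) c (i, 0) (x, t))"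
    if "i \<in> Basis" for i t
    unfolding kink_slice_fst kink_deriv_slice_fst[OF \<eta>s]
    using that \<Omega> by (intro kink_has_weak_deriv smooth_slice_fst \<eta>s) auto
  ultimately show ?thesis
    unfolding L2_time_H10_def using L2 SOME_Basis by blast
qed

lemma kink_zero_initial_value:
  fixes \<eta> :: "'a::euclidean_space \<times> real \<Rightarrow> real"
  assumes \<eta>: "\<eta> \<in> test_functions (cylinder \<Omega> T)" and \<Omega>: "open \<Omega>" "bounded \<Omega>"
  shows "zero_initial_value \<Omega> T (kink \<eta> (a, b) c)"
  unfolding zero_initial_value_def
proof (intro exI[of _ "\<lambda>t x. kink \<eta> (a, b) c (x, t)"] conjI ballI AE_I2 impI refl)
  have \<eta>s: "smooth \<eta>" using \<eta> by (rule test_functions_smooth)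
  show "(\<lambda>x. kink \<eta> (a, b) c (x, t)) \<in> L2 \<Omega>" for t
    using \<eta> \<Omega> unfolding cylinder_def kink_slice_fst
    by (intro H10_L2 kink_H10 test_functions_slice_fst)
  have "bounded (\<Omega> \<times> {0..T})" using \<Omega>(2) by (simp add: bounded_Times)
  then obtain B where B: "\<And>z. z \<in> \<Omega> \<times> {0..T} \<Longrightarrow> \<bar>kink \<eta> (a, b) c z\<bar> \<le> B"
    using kink_bounded[OF \<eta>s _ Basis_prod_intros(2), of "\<Omega> \<times> {0..T}"] by meson
  fix t assume t: "t \<in> {0..T}"
  show "((\<lambda>s. L2_norm \<Omega> (\<lambda>x. kink \<eta> (a, b) c (x, s) - kink \<eta> (a, b) c (x, t))) \<longlongrightarrow> 0)
      (at t within {0..T})"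
  proof (rule L2_norm_slices_tendsto[where B = B])
    show "AE x\<in>\<Omega> in lborel. isCont (\<lambda>s. kink \<eta> (a, b) c (x, s)) t"
      unfolding kink_slice_snd kink_def[abs_def]
      using smooth_continuous[OF smooth_slice_snd[OF \<eta>s], of UNIV]
      by (auto simp: continuous_on_eq_continuous_at intro!: AE_I2 continuous_intros)
  qed (use \<Omega> \<eta>s t B in \<open>auto intro: kink_measurable\<close>)
next
  fix x
  have "(x, 0) \<notin> cylinder \<Omega> T" by (simp add: cylinder_def)
  then show "kink \<eta> (a, b) c (x, 0) = 0"
    using \<eta> by (simp add: kink_def test_functions_outside)
qed

text \<open>The time derivative of the kink is itself continuous in time with values in \<open>L\<^sup>2(\<Omega>)\<close>: for
  \<open>a \<noteq> 0\<close> the kink meets each time slice in a null set. It therefore induces the required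
  continuous curve of functionals.\<close>

lemma kink_zero_initial_velocity:
  fixes \<eta> :: "'a::euclidean_space \<times> real \<Rightarrow> real"
  assumes \<eta>: "\<eta> \<in> test_functions (cylinder \<Omega> T)" and \<Omega>: "open \<Omega>" "bounded \<Omega>" and a: "a \<noteq> 0"
  shows "zero_initial_velocity \<Omega> T (kink \<eta> (a, b) c)"
proof -
  have \<eta>s: "smooth \<eta>" using \<eta> by (rule test_functions_smooth)
  define g where "g = kink_deriv \<eta> (a, b) c (0, 1)"
  define W where "W t u = (LINT x:\<Omega>|lborel. g (x, t) * u x)" for t u
  have borel: "\<Omega> \<in> sets borel" using \<Omega> by simp
  have g_meas: "g \<in> borel_measurable borel"
    unfolding g_def by (intro kink_deriv_measurable \<eta>s Basis_prod_intros)
  have "bounded (\<Omega> \<times> {0..T})" using \<Omega>(2) by (simp add: bounded_Times)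
  then obtain B where B: "\<And>x t. x \<in> \<Omega> \<Longrightarrow> t \<in> {0..T} \<Longrightarrow> \<bar>g (x, t)\<bar> \<le> B"
    unfolding g_def using kink_bounded[OF \<eta>s _ Basis_prod_intros(2), of "\<Omega> \<times> {0..T}" "(a, b)" c]
    by (meson SigmaI)
  have g_L2: "(\<lambda>x. g (x, t)) \<in> L2 \<Omega>" if "t \<in> {0..T}" for t
    using that by (intro L2I_bounded[OF borel \<Omega>(2) slice_measurable[OF g_meas] B])
  have W_cont: "((\<lambda>s. H10_dual_norm \<Omega> (\<lambda>u. W s u - W t u)) \<longlongrightarrow> 0) (at t within {0..T})"
    if t: "t \<in> {0..T}" for t
  proof (rule tendsto_sandwich[OF _ _ tendsto_const])
    have diff: "W s u - W t u = (LINT x:\<Omega>|lborel. (g (x, s) - g (x, t)) * u x)"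
      if "s \<in> {0..T}" "u \<in> H10 \<Omega>" for s u
      unfolding W_def left_diff_distrib using that t
      by (intro set_integral_diff(2)[symmetric] L2_mult_integrable g_L2 H10_L2)
    have ev: "\<forall>\<^sub>F s in at t within {0..T}. s \<in> {0..T}"
      by (simp add: eventually_at_topological) blast
    show "\<forall>\<^sub>F s in at t within {0..T}. 0 \<le> H10_dual_norm \<Omega> (\<lambda>u. W s u - W t u)"
      using ev by eventually_elim
        (use t in \<open>auto intro!: L2_functional_dual_norm(1)[OF \<Omega> L2_diff[OF g_L2 g_L2] diff]\<close>)
    show "\<forall>\<^sub>F s in at t within {0..T}. H10_dual_norm \<Omega> (\<lambda>u. W s u - W t u)
        \<le> L2_norm \<Omega> (\<lambda>x. g (x, s) - g (x, t))"
      using ev by eventually_elim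
        (use t in \<open>auto intro!: L2_functional_dual_norm(2)[OF \<Omega> L2_diff[OF g_L2 g_L2] diff]\<close>)
    show "((\<lambda>s. L2_norm \<Omega> (\<lambda>x. g (x, s) - g (x, t))) \<longlongrightarrow> 0) (at t within {0..T})"
    proof (rule L2_norm_slices_tendsto[OF borel \<Omega>(2) g_meas B t])
      show "AE x\<in>\<Omega> in lborel. isCont (\<lambda>s. g (x, s)) t"
        using AE_not_on_hyperplane[OF a, of "t * b + c"]
      proof eventually_elim
        fix x assume x: "x \<bullet> a + (t * b + c) \<noteq> 0"
        have 1: "isCont (\<lambda>s. \<eta> (x, s)) t"
          using smooth_continuous[OF smooth_slice_snd[OF \<eta>s], of UNIV]
          by (auto simp: continuous_on_eq_continuous_at)
        have 2: "isCont (\<lambda>s. dir_deriv (0, 1) \<eta> (x, s)) t"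
          using smooth_continuous[OF smooth_slice_snd[OF smooth_dir_deriv[OF \<eta>s Basis_prod_intros(2)]], of UNIV]
          by (auto simp: continuous_on_eq_continuous_at)
        have 3: "isCont (\<lambda>s. sgn ((x, s) \<bullet> (a, b) + c)) t"
          using x by (intro continuous_intros) (auto simp: algebra_simps)
        show "x \<in> \<Omega> \<longrightarrow> isCont (\<lambda>s. g (x, s)) t"
          unfolding g_def kink_deriv_def by (intro impI continuous_intros 1 2 3)
      qed
    qed
  qed
  have zero: "g (x, 0) = 0" for x
  proof -
    have "(x, 0) \<notin> cylinder \<Omega> T" by (simp add: cylinder_def)
    then show ?thesis
      using \<eta> test_functions_dir_deriv[OF \<eta> Basis_prod_intros(2)]
      by (simp add: g_def kink_deriv_def test_functions_outside)
  qed
  show ?thesis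
    unfolding zero_initial_velocity_def
  proof (intro exI[of _ g] conjI exI[of _ W] ballI AE_I2 impI)
    show "has_time_deriv \<Omega> T (kink \<eta> (a, b) c) g"
      unfolding g_def by (rule kink_has_time_deriv[OF \<eta>s \<Omega>])
    show "W t \<in> H10_dual \<Omega>" if "t \<in> {0..T}" for t
      unfolding W_def by (rule L2_functional_dual[OF g_L2[OF that]])
    show "((\<lambda>s. H10_dual_norm \<Omega> (\<lambda>u. W s u - W t u)) \<longlongrightarrow> 0) (at t within {0..T})"
      if "t \<in> {0..T}" for t
      by (rule W_cont[OF that])
  qed (auto simp: W_def zero set_lebesgue_integral_def)
qed

lemma kink_H1_wave:
  fixes \<eta> :: "'a::euclidean_space \<times> real \<Rightarrow> real"
  assumes \<eta>: "\<eta> \<in> test_functions (cylinder \<Omega> T)" and \<Omega>: "open \<Omega>" "bounded \<Omega>"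
    and a: "a \<noteq> 0" and null: "b\<^sup>2 = a \<bullet> a"
  shows "kink \<eta> (a, b) c \<in> H1_wave \<Omega> T"
proof -
  have \<eta>s: "smooth \<eta>" using \<eta> by (rule test_functions_smooth)
  have "kink \<eta> (a, b) c \<in> Hk_time 1 \<Omega> T"
    using kink_has_time_deriv[OF \<eta>s \<Omega>, of T a b c]
    unfolding One_nat_def Hk_time.simps by (auto simp: has_time_deriv_def)
  moreover have "\<exists>g. has_wave \<Omega> T (kink \<eta> (a, b) c) g"
    by (rule exI[of "has_wave \<Omega> T (kink \<eta> (a, b) c)"]) (rule kink_has_wave[OF \<eta>s \<Omega> null])
  ultimately show ?thesis
    using kink_zero_initial_value[OF \<eta> \<Omega>] kink_L2_time_H10[OF \<eta> \<Omega>]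
      kink_zero_initial_velocity[OF \<eta> \<Omega> a]
    by (simp add: H1_wave_def H11_00_def H1_time_0_def)
qed

section \<open>Sobolev functions on the cylinder are Bochner-Sobolev functions of time\<close>

lemma cylinder_Fubini:
  fixes f :: "'a::euclidean_space \<times> real \<Rightarrow> real"
  assumes f: "set_integrable lborel (cylinder \<Omega> T) f"
  shows "set_integrable lborel \<Omega> (\<lambda>x. LINT t:{0<..<T}|lborel. f (x, t))"
    and "(LINT x:\<Omega>|lborel. LINT t:{0<..<T}|lborel. f (x, t)) = (LINT z:cylinder \<Omega> T|lborel. f z)"
    and "AE x\<in>\<Omega> in lborel. set_integrable lborel {0<..<T} (\<lambda>t. f (x, t))"
proof -
  define F where "F z = indicator (cylinder \<Omega> T) z *\<^sub>R f z" for z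
  have F: "integrable (lborel \<Otimes>\<^sub>M lborel) F"
    using f by (simp add: F_def[abs_def] set_integrable_def lborel_prod)
  have F_split: "F (x, t) = indicator \<Omega> x *\<^sub>R (indicator {0<..<T} t *\<^sub>R f (x, t))" for x t
    by (auto simp: F_def cylinder_def indicator_def)
  have inner: "(LINT t|lborel. F (x, t)) = indicator \<Omega> x *\<^sub>R (LINT t:{0<..<T}|lborel. f (x, t))" for x
    unfolding F_split set_lebesgue_integral_def by (rule integral_scaleR_right)
  show "set_integrable lborel \<Omega> (\<lambda>x. LINT t:{0<..<T}|lborel. f (x, t))"
    using lborel_pair.integrable_fst'[OF F] unfolding inner set_integrable_def .
  have "(LINT x|lborel. LINT t|lborel. F (x, t)) = (LINT z|lborel. F z)"
    using lborel_pair.integral_fst'[OF F] by (simp add: lborel_prod)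
  then show "(LINT x:\<Omega>|lborel. LINT t:{0<..<T}|lborel. f (x, t)) = (LINT z:cylinder \<Omega> T|lborel. f z)"
    unfolding inner by (simp add: F_def set_lebesgue_integral_def)
  show "AE x\<in>\<Omega> in lborel. set_integrable lborel {0<..<T} (\<lambda>t. f (x, t))"
    using lborel_pair.AE_integrable_fst'[OF F]
    by eventually_elim (auto simp: F_split set_integrable_def)
qed

lemma dir_deriv_tensor:
  fixes \<rho> :: "'a::euclidean_space \<Rightarrow> real" and \<phi> :: "real \<Rightarrow> real"
  assumes "smooth \<rho>" "smooth \<phi>"
  shows "dir_deriv (0, 1) (\<lambda>z. \<rho> (fst z) * \<phi> (snd z)) = (\<lambda>z. \<rho> (fst z) * dir_deriv 1 \<phi> (snd z))"
proof -
  have \<rho>: "smooth (\<lambda>z :: 'a \<times> real. \<rho> (fst z))" and \<phi>: "smooth (\<lambda>z :: 'a \<times> real. \<phi> (snd z))"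
    using smooth_affine[OF bounded_linear_fst assms(1), of 0]
      smooth_affine[OF bounded_linear_snd assms(2), of 0] by simp_all
  have "dir_deriv (0, 1) (\<lambda>z :: 'a \<times> real. \<rho> (fst z + 0)) = (\<lambda>z. dir_deriv (fst (0 :: 'a, 1 :: real)) \<rho> (fst z + 0))"
    by (rule dir_deriv_affine[OF smooth_differentiable[OF assms(1)] bounded_linear_fst])
  also have "\<dots> = (\<lambda>z. 0)"
    by (subst dir_deriv_expand[OF smooth_differentiable[OF assms(1)]]) simp
  finally have 1: "dir_deriv (0, 1) (\<lambda>z. \<rho> (fst z)) = (\<lambda>z::'a \<times> real. 0)" by simp
  have 2: "dir_deriv (0, 1) (\<lambda>z. \<phi> (snd z)) = (\<lambda>z::'a \<times> real. dir_deriv 1 \<phi> (snd z))"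
    using dir_deriv_affine[OF smooth_differentiable[OF assms(2)] bounded_linear_snd, of "(0 :: 'a, 1)" 0]
    by simp
  show ?thesis
    unfolding dir_deriv_mult[OF smooth_differentiable[OF \<rho>] smooth_differentiable[OF \<phi>]] 1 2
    by simp
qed

text \<open>Testing with products \<open>\<rho>(x) \<phi>(t)\<close> and integrating in time first shows that the defect of the
  one-dimensional identity for \<open>\<phi>\<close> is orthogonal to every \<open>\<rho>\<close>, hence zero for almost every \<open>x\<close>.\<close>

lemma has_weak_deriv_imp_has_time_deriv:
  fixes v g :: "'a::euclidean_space \<times> real \<Rightarrow> real"
  assumes \<Omega>: "open \<Omega>" "bounded \<Omega>" and v: "has_weak_deriv (cylinder \<Omega> T) (0, 1) v g"
  shows "has_time_deriv \<Omega> T v g"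
  unfolding has_time_deriv_def
proof (intro conjI ballI)
  show L2: "v \<in> L2 (cylinder \<Omega> T)" "g \<in> L2 (cylinder \<Omega> T)"
    using v by (auto simp: has_weak_deriv_def)
  fix \<phi> :: "real \<Rightarrow> real" assume \<phi>: "\<phi> \<in> test_functions {0<..<T}"
  have cyl: "cylinder \<Omega> T \<in> sets borel" "bounded (cylinder \<Omega> T)"
    using \<Omega> by (auto simp: cylinder_borel bounded_cylinder)
  have \<phi>s: "smooth \<phi>" using \<phi> by (rule test_functions_smooth)
  have \<phi>d: "deriv \<phi> = dir_deriv 1 \<phi>" by (rule deriv_eq_dir_deriv[OF \<phi>s])
  have \<phi>ds: "smooth (deriv \<phi>)" using smooth_dir_deriv[OF \<phi>s, of 1] \<phi>d by simp
  define V where "V x = (LINT t:{0<..<T}|lborel. deriv \<phi> t * v (x, t))" for x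
  define G where "G x = (LINT t:{0<..<T}|lborel. \<phi> t * g (x, t))" for x
  have smooth_snd: "smooth (\<lambda>z :: 'a \<times> real. \<psi> (snd z))" if "smooth \<psi>" for \<psi>
    using smooth_affine[OF bounded_linear_snd that, of 0] by simp
  have smooth_fst: "smooth (\<lambda>z :: 'a \<times> real. \<psi> (fst z))" if "smooth \<psi>" for \<psi>
    using smooth_affine[OF bounded_linear_fst that, of 0] by simp
  have int: "set_integrable lborel (cylinder \<Omega> T) (\<lambda>z. \<psi> z * f z)"
    if "smooth \<psi>" "f \<in> L2 (cylinder \<Omega> T)" for \<psi> f
    by (rule L2_mult_integrable[OF smooth_L2[OF that(1) cyl] that(2)])
  have VG_int: "set_integrable lborel \<Omega> V" "set_integrable lborel \<Omega> G"
    using cylinder_Fubini(1)[OF int[OF smooth_snd[OF \<phi>ds] L2(1)]]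
      cylinder_Fubini(1)[OF int[OF smooth_snd[OF \<phi>s] L2(2)]]
    by (simp_all add: V_def[abs_def] G_def[abs_def])
  have "AE x\<in>\<Omega> in lborel. V x + G x = 0"
  proof (rule fundamental_lemma[OF \<Omega>(1)])
    show "set_integrable lborel \<Omega> (\<lambda>x. V x + G x)" using VG_int by (rule set_integral_add)
    fix \<rho> assume \<rho>: "\<rho> \<in> test_functions \<Omega>"
    have \<rho>s: "smooth \<rho>" using \<rho> by (rule test_functions_smooth)
    have slice: "(LINT t:{0<..<T}|lborel. \<psi> t * f (x, t)) * \<rho> x
        = (LINT t:{0<..<T}|lborel. \<rho> x * \<psi> t * f (x, t))" for \<psi> and f :: "'a \<times> real \<Rightarrow> real" and x
      by (simp add: mult.assoc mult.commute[of _ "\<rho> x"])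
    have prod: "smooth (\<lambda>z :: 'a \<times> real. \<rho> (fst z) * \<psi> (snd z))" if "smooth \<psi>" for \<psi>
      using that by (intro smooth_mult smooth_fst smooth_snd \<rho>s)
    note F1 = cylinder_Fubini[OF int[OF prod[OF \<phi>ds] L2(1)]]
      and F2 = cylinder_Fubini[OF int[OF prod[OF \<phi>s] L2(2)]]
    have "(LINT x:\<Omega>|lborel. (V x + G x) * \<rho> x)
        = (LINT x:\<Omega>|lborel. (LINT t:{0<..<T}|lborel. \<rho> x * deriv \<phi> t * v (x, t))
            + (LINT t:{0<..<T}|lborel. \<rho> x * \<phi> t * g (x, t)))"
      by (simp add: distrib_right V_def G_def slice)
    also have "\<dots> = (LINT z:cylinder \<Omega> T|lborel. \<rho> (fst z) * deriv \<phi> (snd z) * v z)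
        + (LINT z:cylinder \<Omega> T|lborel. \<rho> (fst z) * \<phi> (snd z) * g z)"
      using F1(1,2) F2(1,2) by (subst set_integral_add) simp_all
    also have "\<dots> = 0"
    proof -
      have "(\<lambda>z. \<rho> (fst z) * \<phi> (snd z)) \<in> test_functions (cylinder \<Omega> T)"
        unfolding cylinder_def by (rule test_functions_tensor[OF \<rho> \<phi>])
      then have "(LINT z:cylinder \<Omega> T|lborel. v z * (\<rho> (fst z) * deriv \<phi> (snd z)))
          = - (LINT z:cylinder \<Omega> T|lborel. g z * (\<rho> (fst z) * \<phi> (snd z)))"
        using v unfolding has_weak_deriv_def
        by (auto simp: \<phi>d dir_deriv_tensor[OF \<rho>s \<phi>s])
      then show ?thesis by (simp add: mult.commute)
    qed
    finally show "(LINT x:\<Omega>|lborel. (V x + G x) * \<rho> x) = 0" .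
  qed
  then show "AE x\<in>\<Omega> in lborel. (LINT t:{0<..<T}|lborel. deriv \<phi> t * v (x, t))
      = - (LINT t:{0<..<T}|lborel. \<phi> t * g (x, t))"
    by eventually_elim (auto simp: V_def G_def)
qed

lemma sobolev_subset_Hk_time:
  assumes "open \<Omega>" "bounded \<Omega>"
  shows "v \<in> sobolev k (cylinder \<Omega> T) \<Longrightarrow> v \<in> Hk_time k \<Omega> T"
proof (induction k arbitrary: v)
  case (Suc k)
  then obtain g where "g \<in> sobolev k (cylinder \<Omega> T)" "has_weak_deriv (cylinder \<Omega> T) (0, 1) v g"
    using Basis_prod_intros(2) by auto
  then have "g \<in> Hk_time k \<Omega> T" "has_time_deriv \<Omega> T v g"
    using Suc.IH has_weak_deriv_imp_has_time_deriv[OF assms] by blast+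
  then show ?case by (auto simp: has_time_deriv_def)
qed simp

section \<open>A kink has no second derivative in \<open>L\<^sup>1\<close>\<close>

text \<open>The distributional derivative of \<open>sgn (t - \<tau>)\<close> is twice the point mass at \<open>\<tau>\<close>.\<close>

lemma integral_sgn_dir_deriv:
  assumes \<zeta>: "\<zeta> \<in> test_functions {0<..<T}" and \<tau>: "\<tau> \<in> {0<..<T}"
  shows "(LINT t:{0<..<T}|lborel. sgn (t - \<tau>) * dir_deriv 1 \<zeta> t) = - 2 * \<zeta> \<tau>"
proof -
  let ?d = "dir_deriv 1 \<zeta>"
  have s: "smooth \<zeta>" "smooth ?d" using \<zeta> test_functions_smooth smooth_dir_deriv[of \<zeta> 1] by auto
  have cont: "isCont ?d t" for t
    using smooth_continuous[OF s(2), of UNIV] by (simp add: continuous_on_eq_continuous_at)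
  have out: "\<zeta> t = 0" "?d t = 0" if "t \<notin> {0<..<T}" for t
    using test_functions_outside[OF \<zeta> that] test_functions_outside[OF test_functions_dir_deriv[OF \<zeta>] that]
    by auto
  have FTC: "(LINT t|lborel. ?d t * indicator {a..b} t) = \<zeta> b - \<zeta> a"
    and int: "integrable lborel (\<lambda>t. ?d t * indicator {a..b} t)" if "a \<le> b" for a b
  proof -
    show "(LINT t|lborel. ?d t * indicator {a..b} t) = \<zeta> b - \<zeta> a"
      using that smooth_DERIV[OF s(1)] cont by (intro integral_FTC_Icc_real) auto
    have "set_integrable lborel {a..b} ?d"
      by (intro L2_integrable smooth_L2 s) auto
    then show "integrable lborel (\<lambda>t. ?d t * indicator {a..b} t)"
      by (simp add: set_integrable_def mult.commute)
  qed
  have "(LINT t:{0<..<T}|lborel. sgn (t - \<tau>) * ?d t) = (LINT t|lborel. sgn (t - \<tau>) * ?d t)"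
    by (rule set_integral_support) (simp add: out)
  also have "\<dots> = (LINT t|lborel. ?d t * indicator {\<tau>..T} t - ?d t * indicator {0..\<tau>} t)"
  proof (rule Bochner_Integration.integral_cong[OF refl])
    fix t show "sgn (t - \<tau>) * ?d t = ?d t * indicator {\<tau>..T} t - ?d t * indicator {0..\<tau>} t"
      using out[of t] \<tau> by (auto simp: sgn_real_def indicator_def)
  qed
  also have "\<dots> = (\<zeta> T - \<zeta> \<tau>) - (\<zeta> \<tau> - \<zeta> 0)"
    using \<tau> by (simp add: FTC int Bochner_Integration.integral_diff)
  also have "\<dots> = - 2 * \<zeta> \<tau>" using out by simp
  finally show ?thesis .
qed

text \<open>In one dimension the second distributional derivative of \<open>\<eta>(t) \<bar>t - \<tau>\<bar>\<close> is the point mass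
  \<open>2 \<eta>(\<tau>) \<delta>\<^sub>\<tau>\<close> plus a bounded function.\<close>

lemma kink_second_deriv:
  fixes \<eta> :: "real \<Rightarrow> real"
  assumes \<eta>: "smooth \<eta>" and \<phi>: "\<phi> \<in> test_functions {0<..<T}" and \<tau>: "\<tau> \<in> {0<..<T}"
  shows "(LINT t:{0<..<T}|lborel. kink \<eta> 1 (- \<tau>) t * dir_deriv 1 (dir_deriv 1 \<phi>) t)
    = 2 * \<eta> \<tau> * \<phi> \<tau>
      + (LINT t:{0<..<T}|lborel. (kink_deriv (dir_deriv 1 \<eta>) 1 (- \<tau>) 1 t + dir_deriv 1 \<eta> t * sgn (t - \<tau>)) * \<phi> t)"
proof -
  let ?I = "{0<..<T}" and ?\<eta>' = "dir_deriv 1 \<eta>" and ?\<phi>' = "dir_deriv 1 \<phi>"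
  have I: "?I \<in> sets borel" "bounded ?I" by auto
  have \<eta>': "smooth ?\<eta>'" using smooth_dir_deriv[OF \<eta>, of 1] by simp
  have \<phi>': "?\<phi>' \<in> test_functions ?I" using test_functions_dir_deriv[OF \<phi>, of 1] by simp
  note \<phi>s = test_functions_smooth[OF \<phi>] test_functions_smooth[OF \<phi>']
  have sgn_L2: "(\<lambda>t. sgn (t - \<tau>)) \<in> L2 ?I"
    by (rule L2I_bounded[where B = 1]) (auto simp: sgn_real_def)
  have sgn_int: "set_integrable lborel ?I (\<lambda>t. sgn (t - \<tau>) * \<psi> t)" if "smooth \<psi>" for \<psi>
    by (intro L2_mult_integrable sgn_L2 smooth_L2 that I)
  have kink': "has_weak_deriv ?I 1 (kink ?\<eta>' 1 (- \<tau>)) (kink_deriv ?\<eta>' 1 (- \<tau>) 1)"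
    by (intro kink_has_weak_deriv \<eta>' I) simp
  have kink'_int: "set_integrable lborel ?I (\<lambda>t. kink ?\<eta>' 1 (- \<tau>) t * ?\<phi>' t)"
      "set_integrable lborel ?I (\<lambda>t. kink_deriv ?\<eta>' 1 (- \<tau>) 1 t * \<phi> t)"
    using kink' by (auto simp: has_weak_deriv_def intro!: L2_mult_integrable smooth_L2 \<phi>s)
  have "(LINT t:?I|lborel. kink \<eta> 1 (- \<tau>) t * dir_deriv 1 ?\<phi>' t)
      = - (LINT t:?I|lborel. kink_deriv \<eta> 1 (- \<tau>) 1 t * ?\<phi>' t)"
    using kink_has_weak_deriv[OF \<eta> I, of 1 1 "- \<tau>"] \<phi>' by (simp add: has_weak_deriv_def)
  also have "(LINT t:?I|lborel. kink_deriv \<eta> 1 (- \<tau>) 1 t * ?\<phi>' t)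
      = (LINT t:?I|lborel. kink ?\<eta>' 1 (- \<tau>) t * ?\<phi>' t + sgn (t - \<tau>) * (\<eta> t * ?\<phi>' t))"
    by (simp add: kink_deriv_def kink_def algebra_simps)
  also have "\<dots> = (LINT t:?I|lborel. kink ?\<eta>' 1 (- \<tau>) t * ?\<phi>' t)
      + (LINT t:?I|lborel. sgn (t - \<tau>) * (\<eta> t * ?\<phi>' t))"
    by (intro set_integral_add kink'_int sgn_int smooth_mult \<eta> \<phi>s)
  also have "(LINT t:?I|lborel. kink ?\<eta>' 1 (- \<tau>) t * ?\<phi>' t)
      = - (LINT t:?I|lborel. kink_deriv ?\<eta>' 1 (- \<tau>) 1 t * \<phi> t)"
    using kink' \<phi> by (simp add: has_weak_deriv_def)
  also have "(LINT t:?I|lborel. sgn (t - \<tau>) * (\<eta> t * ?\<phi>' t))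
      = - 2 * (\<phi> \<tau> * \<eta> \<tau>) - (LINT t:?I|lborel. sgn (t - \<tau>) * (?\<eta>' t * \<phi> t))"
  proof -
    have d: "dir_deriv 1 (\<lambda>t. \<phi> t * \<eta> t) = (\<lambda>t. \<phi> t * ?\<eta>' t + ?\<phi>' t * \<eta> t)"
      by (intro dir_deriv_mult smooth_differentiable \<phi>s \<eta>)
    have "- 2 * (\<phi> \<tau> * \<eta> \<tau>) = (LINT t:?I|lborel. sgn (t - \<tau>) * (?\<eta>' t * \<phi> t) + sgn (t - \<tau>) * (\<eta> t * ?\<phi>' t))"
      using integral_sgn_dir_deriv[OF test_functions_mult[OF \<phi> \<eta>] \<tau>] unfolding d
      by (simp add: algebra_simps)
    also have "\<dots> = (LINT t:?I|lborel. sgn (t - \<tau>) * (?\<eta>' t * \<phi> t))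
        + (LINT t:?I|lborel. sgn (t - \<tau>) * (\<eta> t * ?\<phi>' t))"
      by (intro set_integral_add sgn_int smooth_mult \<eta> \<eta>' \<phi>s)
    finally show ?thesis by simp
  qed
  also have "(LINT t:?I|lborel. (kink_deriv ?\<eta>' 1 (- \<tau>) 1 t + ?\<eta>' t * sgn (t - \<tau>)) * \<phi> t)
      = (LINT t:?I|lborel. kink_deriv ?\<eta>' 1 (- \<tau>) 1 t * \<phi> t)
        + (LINT t:?I|lborel. sgn (t - \<tau>) * (?\<eta>' t * \<phi> t))"
  proof -
    have "(\<lambda>t. (kink_deriv ?\<eta>' 1 (- \<tau>) 1 t + ?\<eta>' t * sgn (t - \<tau>)) * \<phi> t)
        = (\<lambda>t. kink_deriv ?\<eta>' 1 (- \<tau>) 1 t * \<phi> t + sgn (t - \<tau>) * (?\<eta>' t * \<phi> t))"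
      by (auto simp: algebra_simps)
    then show ?thesis
      by (simp only:) (intro set_integral_add kink'_int sgn_int smooth_mult \<eta>' \<phi>s)
  qed
  ultimately show ?thesis by simp
qed

lemma bump_ge:
  fixes \<tau> q :: real
  assumes "r > 0" "\<bar>\<tau> - q\<bar> \<le> r / 2"
  shows "flat 1 (3 / 4) \<le> bump q r \<tau>"
proof -
  have "\<bar>\<tau> - q\<bar> / r \<le> 1 / 2" using assms by (simp add: field_simps)
  then have "(\<bar>\<tau> - q\<bar> / r)\<^sup>2 \<le> (1 / 2)\<^sup>2" using assms by (intro power_mono) auto
  then show ?thesis unfolding bump_def by (intro flat_1_mono) (simp add: power2_eq_square)
qed

text \<open>Bumps of fixed height that shrink towards \<open>\<tau>\<close> have integrals against \<open>k\<close> that tend to zero, but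
  their values at \<open>\<tau>\<close> do not. Only countably many test functions enter, those with rational
  centre and radius \<open>1/(n+1)\<close>, because the identity is available for almost every \<open>x\<close> with an
  exceptional set that depends on the test function.\<close>

lemma point_mass_not_integrable:
  fixes \<tau> T A :: real
  assumes \<tau>: "\<tau> \<in> {0<..<T}" and k: "set_integrable lborel {0<..<T} k" and "A \<noteq> 0"
    and repr: "\<And>q n. q \<in> \<rat> \<Longrightarrow> bump q (1 / Suc n) \<in> test_functions {0<..<T} \<Longrightarrow>
      A * bump q (1 / Suc n) \<tau> = (LINT t:{0<..<T}|lborel. k t * bump q (1 / Suc n) t)"
  shows False
proof -
  define r where "r n = 1 / real (Suc n)" for n
  have r: "r n > 0" for n by (simp add: r_def)
  have r_lim: "r \<longlonglongrightarrow> 0" unfolding r_def by (rule LIMSEQ_Suc[OF lim_1_over_n])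
  (* A centre within half the radius keeps the value at \<tau> above flat 1 (3 / 4) = flat 1 (1 - (1/2)^2). *)
  have "\<exists>q. q \<in> \<rat> \<and> \<tau> - r n / 2 < q \<and> q < \<tau>" for n
    using Rats_dense_in_real[of "\<tau> - r n / 2" \<tau>] r[of n] by auto
  then obtain q where q: "\<And>n. q n \<in> \<rat>" "\<And>n. \<tau> - r n / 2 < q n" "\<And>n. q n < \<tau>" by metis
  have "(\<lambda>n. LINT t:{0<..<T}|lborel. bump (q n) (r n) t * k t) \<longlonglongrightarrow> (LINT t:{0<..<T}|lborel. 0 * k t)"
  proof (rule set_integral_bounded_convergence[where B = 1])
    have "(\<lambda>n. bump (q n) (r n) t) \<longlonglongrightarrow> 0" if "t \<noteq> \<tau>" for t
    proof (rule tendsto_eventually)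
      have "\<forall>\<^sub>F n in sequentially. r n < \<bar>t - \<tau>\<bar> / 2"
        using order_tendstoD(2)[OF r_lim, of "\<bar>t - \<tau>\<bar> / 2"] that by simp
      then show "\<forall>\<^sub>F n in sequentially. bump (q n) (r n) t = 0"
      proof eventually_elim
        fix n assume "r n < \<bar>t - \<tau>\<bar> / 2"
        then have "t \<notin> ball (q n) (r n)"
          using q(2,3)[of n] r[of n] by (auto simp: dist_real_def)
        then show "bump (q n) (r n) t = 0"
          using bump_pos_iff[OF r[of n], of "q n" t] bump_bounds(1)[of "q n" "r n" t] by linarith
      qed
    qed
    then show "AE t\<in>{0<..<T} in lborel. (\<lambda>n. bump (q n) (r n) t) \<longlonglongrightarrow> 0"
      using AE_lborel_singleton[of \<tau>] by auto
    show "\<bar>bump (q n) (r n) t\<bar> \<le> 1" for n t using bump_bounds[of "q n" "r n" t] by linarith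
  qed (use k in \<open>auto intro!: smooth_measurable smooth_bump\<close>)
  then have lim: "(\<lambda>n. LINT t:{0<..<T}|lborel. k t * bump (q n) (r n) t) \<longlonglongrightarrow> 0"
    by (simp add: mult.commute)
  have "\<bar>A\<bar> * flat 1 (3 / 4) > 0" using \<open>A \<noteq> 0\<close> by (simp add: flat_def)
  from order_tendstoD(2)[OF tendsto_rabs_zero[OF lim] this]
  have "\<forall>\<^sub>F n in sequentially. \<bar>LINT t:{0<..<T}|lborel. k t * bump (q n) (r n) t\<bar> < \<bar>A\<bar> * flat 1 (3 / 4)" .
  moreover have "\<forall>\<^sub>F n in sequentially. r n < min \<tau> (T - \<tau>) / 2"
    using order_tendstoD(2)[OF r_lim, of "min \<tau> (T - \<tau>) / 2"] \<tau> by simp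
  ultimately have "\<forall>\<^sub>F n in sequentially. False"
  proof eventually_elim
    fix n
    assume small: "\<bar>LINT t:{0<..<T}|lborel. k t * bump (q n) (r n) t\<bar> < \<bar>A\<bar> * flat 1 (3 / 4)"
      and rn: "r n < min \<tau> (T - \<tau>) / 2"
    have "cball (q n) (r n) \<subseteq> {0<..<T}"
      using rn q(2,3)[of n] r[of n] by (auto simp: dist_real_def)
    then have "A * bump (q n) (r n) \<tau> = (LINT t:{0<..<T}|lborel. k t * bump (q n) (r n) t)"
      using repr[OF q(1), of n n] bump_test_function[OF r[of n], of "q n"] by (simp add: r_def)
    moreover have "\<bar>A\<bar> * flat 1 (3 / 4) \<le> \<bar>A\<bar> * bump (q n) (r n) \<tau>"
      using q(2,3)[of n] r[of n] by (intro mult_left_mono bump_ge) auto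
    moreover have "\<bar>A * bump (q n) (r n) \<tau>\<bar> = \<bar>A\<bar> * bump (q n) (r n) \<tau>"
      using bump_bounds(1)[of "q n" "r n" \<tau>] by (simp add: abs_mult)
    ultimately show False using small by linarith
  qed
  then show False by simp
qed

lemma AE_meets_open:
  fixes U :: "'a::euclidean_space set"
  assumes "AE x in lborel. P x" "open U" "U \<noteq> {}"
  shows "\<exists>x\<in>U. P x"
proof (rule ccontr)
  assume "\<not> ?thesis"
  then have "AE x in lborel. x \<notin> U" using assms(1) by (auto elim!: AE_mp)
  then have "U \<in> null_sets lborel" using assms(2) by (subst AE_iff_null_sets) auto
  then have "negligible U" by (simp add: negligible_iff_null_sets null_sets_completionI)
  then show False using open_not_negligible assms by blast
qed

text \<open>A second time derivative \<open>h\<close> in \<open>L\<^sup>2(Q)\<close> would represent, on almost every line in the time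
  direction, the second derivative of \<open>\<eta>(x,t) \<bar>t - \<tau>(x)\<bar>\<close> by an integrable function, where \<open>\<tau>(x)\<close> is the
  time at which the line meets the kink. The lines with \<open>\<eta>(x, \<tau>(x)) \<noteq> 0\<close> form a nonempty open
  set, so one of them is not exceptional, and there the point mass gives a contradiction.\<close>

lemma kink_not_Hk_time_2:
  fixes \<eta> :: "'a::euclidean_space \<times> real \<Rightarrow> real"
  assumes \<eta>: "\<eta> \<in> test_functions (cylinder \<Omega> T)" and \<Omega>: "open \<Omega>" "bounded \<Omega>"
    and nz: "\<eta> (x\<^sub>0, - (x\<^sub>0 \<bullet> a + c)) \<noteq> 0"
  shows "kink \<eta> (a, 1) c \<notin> Hk_time 2 \<Omega> T"
proof
  let ?v = "kink \<eta> (a, 1) c" and ?I = "{0<..<T}"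
  have \<eta>s: "smooth \<eta>" using \<eta> by (rule test_functions_smooth)
  have cyl: "cylinder \<Omega> T \<in> sets borel" "bounded (cylinder \<Omega> T)"
    using \<Omega> by (auto simp: cylinder_borel bounded_cylinder)
  assume "?v \<in> Hk_time 2 \<Omega> T"
  then obtain g h where g: "has_time_deriv \<Omega> T ?v g" and h: "has_time_deriv \<Omega> T g h"
    by (auto simp: numeral_2_eq_2)
  have second: "AE x\<in>\<Omega> in lborel. (LINT t:?I|lborel. ?v (x, t) * dir_deriv 1 (dir_deriv 1 \<phi>) t)
      = (LINT t:?I|lborel. h (x, t) * \<phi> t)" if \<phi>: "\<phi> \<in> test_functions ?I" for \<phi>
  proof -
    have \<phi>': "dir_deriv 1 \<phi> \<in> test_functions ?I" using test_functions_dir_deriv[OF \<phi>, of 1] by simp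
    have d: "deriv \<phi> = dir_deriv 1 \<phi>" "deriv (dir_deriv 1 \<phi>) = dir_deriv 1 (dir_deriv 1 \<phi>)"
      using deriv_eq_dir_deriv test_functions_smooth[OF \<phi>] test_functions_smooth[OF \<phi>'] by auto
    have "AE x\<in>\<Omega> in lborel. (LINT t:?I|lborel. dir_deriv 1 (dir_deriv 1 \<phi>) t * ?v (x, t))
        = - (LINT t:?I|lborel. dir_deriv 1 \<phi> t * g (x, t))"
      using has_time_derivD[OF g \<phi>'] by (simp only: d)
    moreover have "AE x\<in>\<Omega> in lborel. (LINT t:?I|lborel. dir_deriv 1 \<phi> t * g (x, t))
        = - (LINT t:?I|lborel. \<phi> t * h (x, t))"
      using has_time_derivD[OF h \<phi>] by (simp only: d)
    ultimately show ?thesis by eventually_elim (auto simp: mult.commute)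
  qed
  define good where "good x \<longleftrightarrow> set_integrable lborel ?I (\<lambda>t. h (x, t)) \<and>
      (\<forall>q n. q \<in> \<rat> \<longrightarrow> bump q (1 / Suc n) \<in> test_functions ?I \<longrightarrow>
      (LINT t:?I|lborel. ?v (x, t) * dir_deriv 1 (dir_deriv 1 (bump q (1 / Suc n))) t)
        = (LINT t:?I|lborel. h (x, t) * bump q (1 / Suc n) t))" for x
  have "AE x in lborel. \<forall>(q, n)\<in>\<rat> \<times> (UNIV :: nat set). x \<in> \<Omega> \<longrightarrow>
      bump q (1 / Suc n) \<in> test_functions ?I \<longrightarrow>
      (LINT t:?I|lborel. ?v (x, t) * dir_deriv 1 (dir_deriv 1 (bump q (1 / Suc n))) t)
        = (LINT t:?I|lborel. h (x, t) * bump q (1 / Suc n) t)"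
  proof (subst AE_ball_countable)
    show "countable (\<rat> \<times> (UNIV :: nat set))" by (intro countable_SIGMA countable_rat) auto
    show "\<forall>p\<in>\<rat> \<times> UNIV. AE x in lborel. case p of (q, n) \<Rightarrow> x \<in> \<Omega> \<longrightarrow>
      bump q (1 / Suc n) \<in> test_functions ?I \<longrightarrow>
      (LINT t:?I|lborel. ?v (x, t) * dir_deriv 1 (dir_deriv 1 (bump q (1 / Suc n))) t)
        = (LINT t:?I|lborel. h (x, t) * bump q (1 / Suc n) t)"
    proof safe
      fix q :: real and n :: nat
      show "AE x in lborel. x \<in> \<Omega> \<longrightarrow> bump q (1 / Suc n) \<in> test_functions ?I \<longrightarrow>
        (LINT t:?I|lborel. ?v (x, t) * dir_deriv 1 (dir_deriv 1 (bump q (1 / Suc n))) t)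
          = (LINT t:?I|lborel. h (x, t) * bump q (1 / Suc n) t)"
      proof (cases "bump q (1 / Suc n) \<in> test_functions ?I")
        case True
        from second[OF this] show ?thesis by eventually_elim auto
      qed auto
    qed
  qed
  moreover have "AE x\<in>\<Omega> in lborel. set_integrable lborel ?I (\<lambda>t. h (x, t))"
    using h by (intro cylinder_Fubini(3) L2_integrable cyl) (simp add: has_time_deriv_def)
  ultimately have AE: "AE x in lborel. x \<in> \<Omega> \<longrightarrow> good x"
    by eventually_elim (auto simp: good_def)
  define \<tau> where "\<tau> x = - (x \<bullet> a + c)" for x
  define U where "U = {x. \<eta> (x, \<tau> x) \<noteq> 0}"
  have "continuous_on UNIV (\<lambda>x. \<eta> (x, \<tau> x))"
    unfolding \<tau>_def by (rule continuous_on_compose2[OF smooth_continuous[OF \<eta>s, of UNIV]])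
      (auto intro!: continuous_intros)
  then have "open U" unfolding U_def by (intro open_Collect_neq) auto
  moreover have "U \<noteq> {}" using nz by (auto simp: U_def \<tau>_def)
  ultimately obtain x where x: "x \<in> U" "x \<in> \<Omega> \<longrightarrow> good x"
    using AE_meets_open[OF AE] by blast
  have "(x, \<tau> x) \<in> cylinder \<Omega> T"
    using x(1) test_functions_outside[OF \<eta>, of "(x, \<tau> x)"] by (auto simp: U_def)
  then have x\<Omega>: "x \<in> \<Omega>" and \<tau>: "\<tau> x \<in> ?I" by (auto simp: cylinder_def)
  have h_int: "set_integrable lborel ?I (\<lambda>t. h (x, t))"
    and h_repr: "\<And>q n. q \<in> \<rat> \<Longrightarrow> bump q (1 / Suc n) \<in> test_functions ?I \<Longrightarrow>
      (LINT t:?I|lborel. ?v (x, t) * dir_deriv 1 (dir_deriv 1 (bump q (1 / Suc n))) t)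
        = (LINT t:?I|lborel. h (x, t) * bump q (1 / Suc n) t)"
    using x(2) x\<Omega> unfolding good_def by blast+
  define \<eta>x where "\<eta>x t = \<eta> (x, t)" for t
  have \<eta>x: "smooth \<eta>x" "smooth (dir_deriv 1 \<eta>x)"
    using smooth_slice_snd[OF \<eta>s] smooth_dir_deriv[of \<eta>x 1] by (auto simp: \<eta>x_def[abs_def])
  have slice: "?v (x, t) = kink \<eta>x 1 (- \<tau> x) t" for t
    by (simp add: kink_def \<eta>x_def \<tau>_def algebra_simps)
  define k where "k t = kink_deriv (dir_deriv 1 \<eta>x) 1 (- \<tau> x) 1 t + dir_deriv 1 \<eta>x t * sgn (t - \<tau> x)" for t
  have k_L2: "k \<in> L2 ?I"
  proof -
    obtain D where D: "D \<ge> 0" "\<And>t. t \<in> ?I \<Longrightarrow> \<bar>dir_deriv 1 \<eta>x t\<bar> \<le> D"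
      using continuous_bounded_on[OF smooth_continuous[OF \<eta>x(2)], of ?I] by auto
    have "(\<lambda>t. dir_deriv 1 \<eta>x t * sgn (t - \<tau> x)) \<in> L2 ?I"
      using D smooth_measurable[OF \<eta>x(2)]
      by (intro L2I_bounded[where B = D]) (auto simp: abs_mult sgn_real_def)
    moreover have "kink_deriv (dir_deriv 1 \<eta>x) 1 (- \<tau> x) 1 \<in> L2 ?I"
      using kink_has_weak_deriv[OF \<eta>x(2), of ?I 1] by (simp add: has_weak_deriv_def)
    ultimately show ?thesis
      using L2_lincomb[of "kink_deriv (dir_deriv 1 \<eta>x) 1 (- \<tau> x) 1" ?I "\<lambda>t. dir_deriv 1 \<eta>x t * sgn (t - \<tau> x)" 1 1]
      by (simp add: k_def[abs_def])
  qed
  have k_int: "set_integrable lborel ?I k" by (intro L2_integrable k_L2) auto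
  show False
  proof (rule point_mass_not_integrable[OF \<tau>, of "\<lambda>t. h (x, t) - k t" "2 * \<eta>x (\<tau> x)"])
    show "set_integrable lborel ?I (\<lambda>t. h (x, t) - k t)"
      by (intro set_integral_diff h_int k_int)
    show "2 * \<eta>x (\<tau> x) \<noteq> 0" using x(1) by (simp add: U_def \<eta>x_def)
    fix q :: real and n :: nat
    assume q: "q \<in> \<rat>" and \<phi>: "bump q (1 / Suc n) \<in> test_functions ?I"
    let ?\<phi> = "bump q (1 / Suc n)"
    have bnd: "set_integrable lborel ?I (\<lambda>t. f t * ?\<phi> t)" if "set_integrable lborel ?I f" for f
    proof (rule set_integrable_bound[OF that])
      show "set_borel_measurable lborel ?I (\<lambda>t. f t * ?\<phi> t)"
      proof -
        have "(\<lambda>t. (indicator ?I t *\<^sub>R f t) * ?\<phi> t) \<in> borel_measurable lborel"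
          using that smooth_measurable[OF smooth_bump[of q "1 / Suc n"]]
          by (intro borel_measurable_times) (auto simp: set_integrable_def)
        then show ?thesis by (simp add: set_borel_measurable_def mult.assoc)
      qed
      show "AE t in lborel. t \<in> ?I \<longrightarrow> norm (f t * ?\<phi> t) \<le> norm (f t)"
        using bump_bounds[of q "1 / Suc n"] by (auto simp: abs_mult intro!: AE_I2 mult_left_le)
    qed
    have "2 * \<eta>x (\<tau> x) * ?\<phi> (\<tau> x) + (LINT t:?I|lborel. k t * ?\<phi> t)
        = (LINT t:?I|lborel. h (x, t) * ?\<phi> t)"
      using h_repr[OF q \<phi>] kink_second_deriv[OF \<eta>x(1) \<phi> \<tau>] by (simp add: slice k_def)
    moreover have "(LINT t:?I|lborel. (h (x, t) - k t) * ?\<phi> t)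
        = (LINT t:?I|lborel. h (x, t) * ?\<phi> t) - (LINT t:?I|lborel. k t * ?\<phi> t)"
      unfolding left_diff_distrib by (intro set_integral_diff bnd h_int k_int)
    ultimately show "2 * \<eta>x (\<tau> x) * ?\<phi> (\<tau> x) = (LINT t:?I|lborel. (h (x, t) - k t) * ?\<phi> t)"
      by simp
  qed
qed

text \<open>A basis vector \<open>a\<close> is a unit vector, so \<open>(a, 1)\<close> is null; \<open>c\<close> is chosen such that the kink passes
  through the centre of the bump.\<close>

lemma H1_wave_not_H2:
  fixes \<Omega> :: "'a::euclidean_space set"
  assumes \<Omega>: "open \<Omega>" "bounded \<Omega>" "\<Omega> \<noteq> {}" and T: "T > 0"
  shows "\<exists>v\<in>H1_wave \<Omega> T. v \<notin> Hk_time 2 \<Omega> T \<and> v \<notin> sobolev 2 (cylinder \<Omega> T)"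
proof -
  obtain x\<^sub>0 where "x\<^sub>0 \<in> \<Omega>" using \<Omega>(3) by auto
  then have "(x\<^sub>0, T / 2) \<in> cylinder \<Omega> T" using T by (simp add: cylinder_def)
  then obtain r where r: "r > 0" "cball (x\<^sub>0, T / 2) r \<subseteq> cylinder \<Omega> T"
    using open_cylinder[OF \<Omega>(1)] open_contains_cball by metis
  define \<eta> where "\<eta> = bump (x\<^sub>0, T / 2) r"
  have \<eta>: "\<eta> \<in> test_functions (cylinder \<Omega> T)"
    unfolding \<eta>_def by (rule bump_test_function[OF r])
  obtain a :: 'a where a: "a \<in> Basis" using nonempty_Basis by blast
  define c where "c = - (x\<^sub>0 \<bullet> a + T / 2)"
  have "\<eta> (x\<^sub>0, - (x\<^sub>0 \<bullet> a + c)) \<noteq> 0"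
    using bump_pos_iff[OF r(1), of "(x\<^sub>0, T / 2)" "(x\<^sub>0, T / 2)"] r(1) by (simp add: \<eta>_def c_def)
  then have "kink \<eta> (a, 1) c \<notin> Hk_time 2 \<Omega> T"
    by (rule kink_not_Hk_time_2[OF \<eta> \<Omega>(1,2)])
  moreover have "kink \<eta> (a, 1) c \<in> H1_wave \<Omega> T"
    using a nonzero_Basis[OF a] by (intro kink_H1_wave \<eta> \<Omega>) (auto simp: inner_Basis)
  ultimately show ?thesis using sobolev_subset_Hk_time[OF \<Omega>(1,2)] by blast
qed

theorem theorem5:
  fixes \<Omega> :: "(real ^ 'n) set" and T :: real
  assumes "CARD('n) \<in> {1, 2, 3}"
    and "bounded_lipschitz_domain \<Omega>"
    and "T > 0"
  shows "\<not> H1_wave \<Omega> T \<subseteq> Hk_time 2 \<Omega> T \<and>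
    \<not> H1_wave \<Omega> T \<subseteq> sobolev 2 (cylinder \<Omega> T)"
  using H1_wave_not_H2[of \<Omega> T] assms(2,3) unfolding bounded_lipschitz_domain_def by blast

end
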